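(* Let $K\subset\mathbb{R}^2$ be the compact lamina bounded by a smooth simple closed convex curve $\partial K$ of length $L$, let $A$ be the area of $K$, and set $B(r)=-\pi r^2+Lr-A$ for $r\in\mathbb{R}$. Let $\mathcal{O}$ be the center, $\rho_{\text{in}}$ the inner radius and $\rho_{\text{out}}$ the outer radius of the minimal annulus of $\partial K$. Then $B(r)\ge 0$ for all $r\in[\rho_{\text{in}},\rho_{\text{out}}]$. Moreover, if $h$ is the support function of $\partial K$ based at $\mathcal{O}$, then $\rho_{\text{in}}\le h(s)\le\rho_{\text{out}}$ and $B(h(s))\ge 0$ for every point $s$ of $\partial K$; that is, the center of the minimal annulus is a positive center of $\partial K$.
   Context: Support function: if $X(s)$ is the arc length parametrization of $\partial K$ and $N(s)$ is the inward unit normal, the support function based at a point $\mathcal{O}$ is $h(s)=\langle X(s)-\mathcal{O},-N(s)\rangle$. Minimal annulus: among all pairs of concentric closed Euclidean disks with common center $\mathcal{O}$ and radii $0\le\rho_{\text{in}}\le\rho_{\text{out}}$ such that the disk of radius $\rho_{\text{in}}$ is contained in $K$ and the disk of radius $\rho_{\text{out}}$ contains $K$, there is a unique one minimizing $\rho_{\text{out}}-\rho_{\text{in}}$. The annulus between these two disks is the minimal annulus of $\partial K$; its center is $\mathcal{O}$, its inner radius is $\rho_{\text{in}}$ and its outer radius is $\rho_{\text{out}}$. Positive center: a point $\mathcal{O}$ such that the support function $h$ based at $\mathcal{O}$ satisfies $B(h(s))=-\pi h(s)^2+Lh(s)-A\ge 0$ for all points $s$ of the curve. *)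

theory Defs
  imports "HOL-Analysis.Analysis"
begin

definition smooth_curve :: "(real \<Rightarrow> real^2) \<Rightarrow> bool" where
  "smooth_curve X \<longleftrightarrow>
     (\<forall>n s. ((\<lambda>Y t. vector_derivative Y (at t)) ^^ n) X differentiable (at s))"

(* Arc length parametrization of a smooth simple closed curve, extended
   periodically to the whole line so that smoothness also covers the closing point.
   As the speed is 1, the period L is the length of the curve. *)
definition arc_length_simple_closed :: "(real \<Rightarrow> real^2) \<Rightarrow> real \<Rightarrow> bool" where
  "arc_length_simple_closed X L \<longleftrightarrow>
     smooth_curve X \<and>
     (\<forall>s. norm (vector_derivative X (at s)) = 1) \<and>
     L > 0 \<and> (\<forall>s. X (s + L) = X s) \<and> inj_on X {0..<L}"

definition lamina_bounded_by :: "(real^2) set \<Rightarrow> (real \<Rightarrow> real^2) \<Rightarrow> bool" where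
  "lamina_bounded_by K X \<longleftrightarrow> K = range X \<union> inside (range X)"

(* "Inward" is expressed by pointing into the interior of K, so that no orientation
   of the parametrization has to be fixed. *)
definition inward_unit_normal ::
    "(real^2) set \<Rightarrow> (real \<Rightarrow> real^2) \<Rightarrow> (real \<Rightarrow> real^2) \<Rightarrow> bool" where
  "inward_unit_normal K X N \<longleftrightarrow>
     (\<forall>s. norm (N s) = 1 \<and> N s \<bullet> vector_derivative X (at s) = 0 \<and>
          (\<forall>\<^sub>F t in at_right 0. X s + t *\<^sub>R N s \<in> interior K))"

definition support_function ::
    "(real \<Rightarrow> real^2) \<Rightarrow> (real \<Rightarrow> real^2) \<Rightarrow> real^2 \<Rightarrow> real \<Rightarrow> real" where
  "support_function X N c s = (X s - c) \<bullet> (- N s)"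

definition bonnesen :: "(real^2) set \<Rightarrow> real \<Rightarrow> real \<Rightarrow> real" where
  "bonnesen K L r = - pi * r\<^sup>2 + L * r - measure lebesgue K"

definition bounding_annulus :: "(real^2) set \<Rightarrow> real^2 \<Rightarrow> real \<Rightarrow> real \<Rightarrow> bool" where
  "bounding_annulus K c r R \<longleftrightarrow> 0 \<le> r \<and> r \<le> R \<and> cball c r \<subseteq> K \<and> K \<subseteq> cball c R"

definition minimal_annulus :: "(real^2) set \<Rightarrow> real^2 \<Rightarrow> real \<Rightarrow> real \<Rightarrow> bool" where
  "minimal_annulus K c r R \<longleftrightarrow>
     bounding_annulus K c r R \<and>
     (\<forall>c' r' R'. bounding_annulus K c' r' R' \<longrightarrow> R - r \<le> R' - r')"

definition positive_center ::
    "(real^2) set \<Rightarrow> (real \<Rightarrow> real^2) \<Rightarrow> real \<Rightarrow> (real \<Rightarrow> real^2) \<Rightarrow> real^2 \<Rightarrow> bool" where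
  "positive_center K X L N c \<longleftrightarrow> (\<forall>s. bonnesen K L (support_function X N c s) \<ge> 0)"

end

theory Submission
  imports Defs
begin

text \<open>
  Parametrize the boundary by arc length \<open>s\<close>, with unit tangent \<open>T\<close>, inward normal \<open>N\<close> and curvature
  \<open>\<kappa> \<ge> 0\<close>. Based at the centre \<open>c\<close>, the functions \<open>h = \<langle>X - c, -N\<rangle>\<close> and \<open>\<tau> = \<langle>X - c, T\<rangle>\<close> satisfy
  \<open>h' = \<kappa> \<tau>\<close> and \<open>\<tau>' = 1 - \<kappa> h\<close>. Integrating \<open>(h \<tau>)'\<close> and \<open>\<tau>'\<close> over one period gives, for every \<open>r\<close>,

  \<open>\<integral> \<kappa> (\<tau>\<^sup>2 - (h - r)\<^sup>2) ds = 2 r L - \<integral> h ds - r\<^sup>2 \<integral> \<kappa> ds \<le> 2 B(r)\<close>,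

  because the area is at most \<open>(\<integral> h ds) / 2\<close> and the total curvature is at least \<open>2 \<pi>\<close>. So it is
  enough that the left side is nonnegative. In terms of the normal angle \<open>\<theta>\<close>, where \<open>d\<theta> = \<kappa> ds\<close>, it is
  the Wirtinger functional \<open>\<integral> (H'\<^sup>2 - (H - r)\<^sup>2) d\<theta>\<close> of the support function \<open>H\<close>, with \<open>h(s) = H(\<theta>(s))\<close>.
  The computation stays in \<open>s\<close> because \<open>H\<close> has corners where the boundary is flat.

  Over a half turn \<open>[\<phi>, \<phi> + \<pi>]\<close> this functional is nonnegative as soon as \<open>H\<close> has equal values at both
  ends and takes the value \<open>r\<close> in between: extended with period \<open>\<pi>\<close>, the function \<open>H - r\<close> then vanishes
  at two points a distance \<open>\<pi>\<close> apart (lemma \<open>wirtinger_half_turn\<close>). It remains to find one \<open>\<phi>\<close> for which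
  \<open>H(\<phi>) = H(\<phi> + \<pi>)\<close> and both half turns contain contact directions of the inner and of the outer
  circle, that is, directions with \<open>H = \<rho>\<^sub>i\<^sub>n\<close> and with \<open>H = \<rho>\<^sub>o\<^sub>u\<^sub>t\<close>.

  Here minimality enters. If a line separated the two kinds of contact directions, moving the centre
  perpendicularly to that line would make the annulus thinner (\<open>no_separation\<close>). Hence they cannot be
  separated, and on a circle this means, when the two radii differ, that one finds four of them in
  alternating order (\<open>alternating_contacts\<close>). The inner radius has room to shrink in this argument:
  it is positive, because \<open>K\<close> has no corners (\<open>inner_radius_pos\<close>). The difference \<open>H(t + \<pi>) - H(t)\<close> is \<open>\<le> 0\<close> at outer and \<open>\<ge> 0\<close> at inner
  contacts, so it vanishes between neighbouring ones, and a suitable pair of neighbours yields \<open>\<phi>\<close>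
  (\<open>balanced_line\<close>).
\<close>


section \<open>Wirtinger's inequality along a curve\<close>

text \<open>
  The data of a convex curve seen from a base point. Only these differential equations enter
  Wirtinger's inequality; \<open>\<kappa>\<close> may vanish on intervals, so \<open>\<theta>\<close> need not be a valid parameter.
\<close>
locale support_profile =
  fixes h \<tau> \<kappa> \<theta> :: "real \<Rightarrow> real"
  assumes h_deriv: "(h has_real_derivative \<kappa> s * \<tau> s) (at s)"
    and \<tau>_deriv: "(\<tau> has_real_derivative 1 - \<kappa> s * h s) (at s)"
    and \<theta>_deriv: "(\<theta> has_real_derivative \<kappa> s) (at s)"
    and \<kappa>_nonneg: "\<kappa> s \<ge> 0"
    and \<kappa>_cont: "continuous_on UNIV \<kappa>"
begin

lemma \<kappa>_cont_on [continuous_intros]: "continuous_on S \<kappa>"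
  using \<kappa>_cont by (rule continuous_on_subset) simp

lemma h_cont_on [continuous_intros]: "continuous_on S h"
  by (rule DERIV_continuous_on) (rule has_field_derivative_at_within[OF h_deriv])

lemma \<tau>_cont_on [continuous_intros]: "continuous_on S \<tau>"
  by (rule DERIV_continuous_on) (rule has_field_derivative_at_within[OF \<tau>_deriv])

lemma \<theta>_cont_on [continuous_intros]: "continuous_on S \<theta>"
  by (rule DERIV_continuous_on) (rule has_field_derivative_at_within[OF \<theta>_deriv])

lemma \<theta>_mono: "s \<le> t \<Longrightarrow> \<theta> s \<le> \<theta> t"
  using DERIV_nonneg_imp_nondecreasing[of s t \<theta>] \<theta>_deriv \<kappa>_nonneg by blast

text \<open>
  Completing the square with a solution \<open>W\<close> of the Riccati equation \<open>W' = - \<omega>\<^sup>2 - W\<^sup>2\<close>: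
  \<open>\<kappa> (\<tau>\<^sup>2 - \<omega>\<^sup>2 (h - r)\<^sup>2) - ((h - r)\<^sup>2 W)' = \<kappa> (\<tau> - (h - r) W)\<^sup>2 \<ge> 0\<close>. For \<open>\<omega> = 1\<close> the function \<open>W\<close>
  would be the cotangent, singular at both ends of the half turn; \<open>\<omega> < 1\<close> keeps it smooth there.
\<close>
lemma wirtinger_piece:
  fixes \<omega> x r :: real
  assumes "p \<le> q" and \<omega>: "0 < \<omega>" "\<omega> < 1"
    and range: "\<And>s. s \<in> {p..q} \<Longrightarrow> 0 \<le> \<theta> s - x \<and> \<theta> s - x \<le> pi"
  defines "W \<equiv> \<lambda>y. - \<omega> * tan (\<omega> * (y - pi / 2))"
  shows "(h q - r)\<^sup>2 * W (\<theta> q - x) - (h p - r)\<^sup>2 * W (\<theta> p - x)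
      \<le> integral {p..q} (\<lambda>s. \<kappa> s * ((\<tau> s)\<^sup>2 - \<omega>\<^sup>2 * (h s - r)\<^sup>2))"
proof -
  define G where "G = (\<lambda>s. (h s - r)\<^sup>2 * W (\<theta> s - x))"
  define D where "D = (\<lambda>s. 2 * (h s - r) * (\<kappa> s * \<tau> s) * W (\<theta> s - x)
      - (h s - r)\<^sup>2 * \<kappa> s * (\<omega>\<^sup>2 + (W (\<theta> s - x))\<^sup>2))"
  have cos_pos: "cos (\<omega> * (\<theta> s - x - pi / 2)) > 0" if "s \<in> {p..q}" for s
  proof (rule cos_gt_zero_pi)
    have b: "\<bar>\<theta> s - x - pi / 2\<bar> \<le> pi / 2" using range[OF that] by (intro abs_leI) linarith+
    have "\<bar>\<omega> * (\<theta> s - x - pi / 2)\<bar> \<le> \<omega> * (pi / 2)"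
      using b \<omega> by (simp add: abs_mult)
    also have "\<dots> < pi / 2" using \<omega> by simp
    finally show "- (pi / 2) < \<omega> * (\<theta> s - x - pi / 2)" "\<omega> * (\<theta> s - x - pi / 2) < pi / 2"
      by linarith+
  qed
  have "(G has_real_derivative D s) (at s)" if s: "s \<in> {p..q}" for s
  proof -
    let ?a = "\<omega> * (\<theta> s - x - pi / 2)"
    have "((\<lambda>s. tan (\<omega> * (\<theta> s - x - pi / 2))) has_real_derivative
        (1 + (tan ?a)\<^sup>2) * (\<omega> * \<kappa> s)) (at s)"
      using cos_pos[OF s]
      by (auto intro!: derivative_eq_intros \<theta>_deriv simp: tan_sec power_inverse)
    then have "((\<lambda>s. W (\<theta> s - x)) has_real_derivative
        - \<omega> * ((1 + (tan ?a)\<^sup>2) * (\<omega> * \<kappa> s))) (at s)"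
      unfolding W_def by (rule DERIV_cmult)
    moreover have "((\<lambda>s. (h s - r)\<^sup>2) has_real_derivative 2 * (h s - r) * (\<kappa> s * \<tau> s)) (at s)"
      by (auto intro!: derivative_eq_intros h_deriv)
    ultimately have "(G has_real_derivative 2 * (h s - r) * (\<kappa> s * \<tau> s) * W (\<theta> s - x)
        + - \<omega> * ((1 + (tan ?a)\<^sup>2) * (\<omega> * \<kappa> s)) * (h s - r)\<^sup>2) (at s)"
      unfolding G_def by (rule DERIV_mult[rotated])
    then show ?thesis
      by (rule DERIV_cong) (simp add: D_def W_def power2_eq_square algebra_simps)
  qed
  then have FTC: "(D has_integral (G q - G p)) {p..q}"
    by (intro fundamental_theorem_of_calculus \<open>p \<le> q\<close>)
      (auto simp: has_real_derivative_iff_has_vector_derivative intro: has_vector_derivative_at_within)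
  have "(\<lambda>s. \<kappa> s * ((\<tau> s)\<^sup>2 - \<omega>\<^sup>2 * (h s - r)\<^sup>2)) integrable_on {p..q}"
    by (intro integrable_continuous_real continuous_intros)
  then have "integral {p..q} D \<le> integral {p..q} (\<lambda>s. \<kappa> s * ((\<tau> s)\<^sup>2 - \<omega>\<^sup>2 * (h s - r)\<^sup>2))"
  proof (rule integral_le[OF has_integral_integrable[OF FTC]])
    fix s assume "s \<in> {p..q}"
    have "\<kappa> s * ((\<tau> s)\<^sup>2 - \<omega>\<^sup>2 * (h s - r)\<^sup>2) - D s = \<kappa> s * (\<tau> s - (h s - r) * W (\<theta> s - x))\<^sup>2"
      by (simp add: D_def power2_eq_square algebra_simps)
    also have "\<dots> \<ge> 0" using \<kappa>_nonneg by simp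
    finally show "D s \<le> \<kappa> s * ((\<tau> s)\<^sup>2 - \<omega>\<^sup>2 * (h s - r)\<^sup>2)" by simp
  qed
  then show ?thesis
    using integral_unique[OF FTC] by (simp add: G_def)
qed

text \<open>
  Cut the interval at the zero \<open>c\<close> of \<open>h - r\<close> and move the left part by a half turn, behind the right
  part. On the joined half turn one function \<open>W\<close> serves both parts; the boundary terms vanish at \<open>c\<close>
  and cancel at the joint, where \<open>h\<close> has equal values. Finally let \<open>\<omega>\<close> tend to \<open>1\<close>.
\<close>
lemma wirtinger_half_turn:
  assumes "a \<le> b" and turn: "\<theta> b = \<theta> a + pi" and ends: "h a = h b"
    and c: "c \<in> {a..b}" "h c = r"
  shows "integral {a..b} (\<lambda>s. \<kappa> s * ((\<tau> s)\<^sup>2 - (h s - r)\<^sup>2)) \<ge> 0"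
proof -
  define I where "I = integral {a..b} (\<lambda>s. \<kappa> s * (\<tau> s)\<^sup>2)"
  define J where "J = integral {a..b} (\<lambda>s. \<kappa> s * (h s - r)\<^sup>2)"
  have split: "integral {a..b} (\<lambda>s. \<kappa> s * ((\<tau> s)\<^sup>2 - e * (h s - r)\<^sup>2)) = I - e * J" for e
  proof -
    have "integral {a..b} (\<lambda>s. \<kappa> s * (\<tau> s)\<^sup>2 - e * (\<kappa> s * (h s - r)\<^sup>2)) = I - e * J"
      unfolding I_def J_def
      by (subst integral_diff) (auto intro!: integrable_continuous_real continuous_intros)
    then show ?thesis by (simp add: algebra_simps)
  qed
  have approx: "0 \<le> I - \<omega>\<^sup>2 * J" if \<omega>: "0 < \<omega>" "\<omega> < 1" for \<omega>
  proof -
    define W where "W = (\<lambda>y. - \<omega> * tan (\<omega> * (y - pi / 2)))"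
    define f where "f = (\<lambda>s. \<kappa> s * ((\<tau> s)\<^sup>2 - \<omega>\<^sup>2 * (h s - r)\<^sup>2))"
    have mono: "\<theta> a \<le> \<theta> s \<and> \<theta> s \<le> \<theta> c" if "s \<in> {a..c}" for s
      using that \<theta>_mono by auto
    have mono': "\<theta> c \<le> \<theta> s \<and> \<theta> s \<le> \<theta> b" if "s \<in> {c..b}" for s
      using that \<theta>_mono by auto
    have ac: "\<theta> a \<le> \<theta> c" and cb: "\<theta> c \<le> \<theta> b" using c \<theta>_mono by auto
    have "(h c - r)\<^sup>2 * W (\<theta> c - (\<theta> c - pi)) - (h a - r)\<^sup>2 * W (\<theta> a - (\<theta> c - pi))
        \<le> integral {a..c} f"
      unfolding W_def f_def using \<omega> c
      by (intro wirtinger_piece) (use mono cb turn in fastforce)+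
    moreover have "(h b - r)\<^sup>2 * W (\<theta> b - \<theta> c) - (h c - r)\<^sup>2 * W (\<theta> c - \<theta> c)
        \<le> integral {c..b} f"
      unfolding W_def f_def using \<omega> c
      by (intro wirtinger_piece) (use mono' ac turn in fastforce)+
    moreover have "integral {a..c} f + integral {c..b} f = integral {a..b} f"
      using c unfolding f_def
      by (intro Henstock_Kurzweil_Integration.integral_combine integrable_continuous_real continuous_intros) auto
    moreover have "\<theta> a - (\<theta> c - pi) = \<theta> b - \<theta> c" using turn by simp
    ultimately have "0 \<le> integral {a..b} f" using c ends by simp
    then show ?thesis using split[of "\<omega>\<^sup>2"] by (simp add: f_def)
  qed
  have "((\<lambda>\<omega>. I - \<omega>\<^sup>2 * J) \<longlongrightarrow> I - 1\<^sup>2 * J) (at_left 1)"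
    by (intro tendsto_intros)
  moreover have "\<forall>\<^sub>F \<omega> in at_left 1. 0 \<le> I - \<omega>\<^sup>2 * J"
    using eventually_at_left_real[of 0 "1::real"] by (rule eventually_mono) (use approx in auto)
  ultimately have "0 \<le> I - 1\<^sup>2 * J"
    by (intro tendsto_lowerbound) auto
  then show ?thesis using split[of 1] by simp
qed

text \<open>
  The turning of the curve will be known to be some positive multiple of \<open>2 \<pi>\<close>, hence the arbitrary
  number of half turns.
\<close>
lemma wirtinger_turns:
  fixes H :: "real \<Rightarrow> real"
  assumes H: "\<And>s. h s = H (\<theta> s)" 
    and ends: "\<And>n::nat. H (\<theta> a + n * pi) = H (\<theta> a)"
    and zero: "\<And>n::nat. \<exists>\<psi>\<in>{\<theta> a + n * pi..\<theta> a + (n + 1) * pi}. H \<psi> = r"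
    and "a \<le> b" and "\<theta> b = \<theta> a + (Suc n) * pi"
  shows "integral {a..b} (\<lambda>s. \<kappa> s * ((\<tau> s)\<^sup>2 - (h s - r)\<^sup>2)) \<ge> 0"
  using assms(4,5)
proof (induction n arbitrary: b)
  case 0
  obtain \<psi> where \<psi>: "\<theta> a \<le> \<psi>" "\<psi> \<le> \<theta> b" "H \<psi> = r" using zero[of 0] 0 by auto
  obtain c where c: "a \<le> c" "c \<le> b" "\<theta> c = \<psi>"
    using IVT'[of \<theta> a \<psi> b] \<psi> 0 by (auto intro: continuous_intros)
  show ?case
    using 0 c \<psi> ends[of 1] by (intro wirtinger_half_turn[where c = c]) (auto simp: H)
next
  case (Suc n)
  let ?f = "\<lambda>s. \<kappa> s * ((\<tau> s)\<^sup>2 - (h s - r)\<^sup>2)"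
  have "\<theta> a \<le> \<theta> a + real (Suc n) * pi" "\<theta> a + real (Suc n) * pi \<le> \<theta> b"
    using Suc.prems by auto
  then obtain m where m: "a \<le> m" "m \<le> b" "\<theta> m = \<theta> a + real (Suc n) * pi"
    using IVT'[of \<theta> a "\<theta> a + real (Suc n) * pi" b] Suc.prems by (auto intro: continuous_intros)
  have b: "\<theta> b = \<theta> m + pi" using m Suc.prems by (simp add: algebra_simps)
  obtain \<psi> where \<psi>: "\<theta> m \<le> \<psi>" "\<psi> \<le> \<theta> b" "H \<psi> = r" 
    using zero[of "Suc n"] m b by (auto simp: algebra_simps)
  obtain c where c: "m \<le> c" "c \<le> b" "\<theta> c = \<psi>"
    using IVT'[of \<theta> m \<psi> b] \<psi> m by (auto intro: continuous_intros)
  have "h m = h b" using ends[of "Suc n"] ends[of "Suc (Suc n)"] m Suc.prems by (simp add: H)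
  then have "0 \<le> integral {m..b} ?f"
    using c \<psi> m b by (intro wirtinger_half_turn[where c = c]) (auto simp: H)
  moreover have "0 \<le> integral {a..m} ?f" using Suc.IH m by blast
  moreover have "integral {a..m} ?f + integral {m..b} ?f = integral {a..b} ?f"
    using m by (intro Henstock_Kurzweil_Integration.integral_combine integrable_continuous_real continuous_intros) auto
  ultimately show ?case by simp
qed

text \<open>
  The integrand plus \<open>h\<close> is the derivative of \<open>h \<tau> + 2 r (s - \<tau>) - r\<^sup>2 \<theta>\<close>.
\<close>
lemma energy_integral:
  assumes "a \<le> b" "h b = h a" "\<tau> b = \<tau> a"
  shows "integral {a..b} (\<lambda>s. \<kappa> s * ((\<tau> s)\<^sup>2 - (h s - r)\<^sup>2))
    = 2 * r * (b - a) - integral {a..b} h - r\<^sup>2 * (\<theta> b - \<theta> a)"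
proof -
  define F where "F = (\<lambda>s. h s * \<tau> s + 2 * r * (s - \<tau> s) - r\<^sup>2 * \<theta> s)"
  have "(F has_real_derivative \<kappa> s * ((\<tau> s)\<^sup>2 - (h s - r)\<^sup>2) + h s) (at s)" for s
    unfolding F_def
    by (auto intro!: derivative_eq_intros h_deriv \<tau>_deriv \<theta>_deriv)
      (simp add: power2_eq_square algebra_simps)
  then have "((\<lambda>s. \<kappa> s * ((\<tau> s)\<^sup>2 - (h s - r)\<^sup>2) + h s) has_integral (F b - F a)) {a..b}"
    by (intro fundamental_theorem_of_calculus \<open>a \<le> b\<close>)
      (auto simp: has_real_derivative_iff_has_vector_derivative intro: has_vector_derivative_at_within)
  then have "integral {a..b} (\<lambda>s. \<kappa> s * ((\<tau> s)\<^sup>2 - (h s - r)\<^sup>2) + h s) = F b - F a"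
    by (rule integral_unique)
  moreover have "integral {a..b} (\<lambda>s. \<kappa> s * ((\<tau> s)\<^sup>2 - (h s - r)\<^sup>2) + h s)
     = integral {a..b} (\<lambda>s. \<kappa> s * ((\<tau> s)\<^sup>2 - (h s - r)\<^sup>2)) + integral {a..b} h"
    by (intro integral_add integrable_continuous_real continuous_intros)
  ultimately show ?thesis using assms by (simp add: F_def algebra_simps)
qed

end

section \<open>Continuous periodic functions\<close>

lemma periodic_int:
  fixes H :: "real \<Rightarrow> 'a"
  assumes "\<And>t. H (t + p) = H t"
  shows "H (t + of_int n * p) = H t"
proof (induction n rule: int_induct[where k = 0])
  case base
  show ?case by simp
next
  case (step1 i)
  then show ?case using assms[of "t + of_int i * p"] by (simp add: algebra_simps)
next
  case (step2 i)
  then show ?case using assms[of "t + of_int (i - 1) * p"] by (simp add: algebra_simps)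
qed

lemma periodic_representative:
  fixes t x p :: real
  assumes "p > 0"
  shows "\<exists>n::int. t + of_int n * p \<in> {x..<x + p}"
proof -
  define n where "n = \<lfloor>(t - x) / p\<rfloor>"
  have "of_int n \<le> (t - x) / p" "(t - x) / p < of_int n + 1"
    unfolding n_def by linarith+
  then have "of_int n * p \<le> t - x" "t - x < of_int n * p + p"
    using assms by (simp_all add: field_simps)
  then show ?thesis by (intro exI[of _ "- n"]) auto
qed

text \<open>
  Compactness of a period turns pointwise strict inequalities into uniform ones.
\<close>
lemma periodic_gap:
  fixes f g :: "real \<Rightarrow> real"
  assumes cont: "continuous_on UNIV f" "continuous_on UNIV g"
    and per: "\<And>t. f (t + 2 * pi) = f t" "\<And>t. g (t + 2 * pi) = g t"
    and pos: "\<And>t. f t \<le> 0 \<Longrightarrow> 0 < g t"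
  obtains \<delta> where "\<delta> > 0" "\<And>t. f t \<le> 0 \<Longrightarrow> \<delta> \<le> g t"
proof -
  define S where "S = {0..2 * pi} \<inter> {t. f t \<le> 0}"
  have "compact S"
    unfolding S_def using cont
    by (intro compact_Int_closed closed_Collect_le) auto
  have "\<exists>\<delta>>0. \<forall>t\<in>S. \<delta> \<le> g t"
  proof (cases "S = {}")
    case True
    then show ?thesis by (intro exI[of _ 1]) auto
  next
    case False
    have "continuous_on S g" using cont(2) by (rule continuous_on_subset) simp
    then obtain t where "t \<in> S" "\<forall>s\<in>S. g t \<le> g s"
      using continuous_attains_inf[OF \<open>compact S\<close> False] by blast
    then show ?thesis using pos by (intro exI[of _ "g t"]) (auto simp: S_def)
  qed
  then obtain \<delta> where \<delta>: "\<delta> > 0" "\<And>t. t \<in> S \<Longrightarrow> \<delta> \<le> g t" by blast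
  show ?thesis
  proof (rule that[OF \<open>\<delta> > 0\<close>])
    fix t assume "f t \<le> 0"
    obtain n :: int where n: "t + of_int n * (2 * pi) \<in> {0..<0 + 2 * pi}"
      using periodic_representative[of "2 * pi" t 0] by auto
    have "f (t + of_int n * (2 * pi)) = f t" "g (t + of_int n * (2 * pi)) = g t"
      using periodic_int[of f "2 * pi"] periodic_int[of g "2 * pi"] per by auto
    then show "\<delta> \<le> g t" using \<delta>(2)[of "t + of_int n * (2 * pi)"] n \<open>f t \<le> 0\<close> by (auto simp: S_def)
  qed
qed

lemma periodic_attains_sup:
  fixes f :: "real \<Rightarrow> real"
  assumes cont: "continuous_on UNIV f" and per: "\<And>t. f (t + 2 * pi) = f t"
  shows "\<exists>t. \<forall>s. f s \<le> f t"
proof -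
  have "continuous_on {0..2 * pi} f" using cont by (rule continuous_on_subset) simp
  moreover have "{0..2 * pi} \<noteq> {}" by simp
  ultimately obtain t where t: "\<And>s. s \<in> {0..2 * pi} \<Longrightarrow> f s \<le> f t"
    using continuous_attains_sup[of "{0..2 * pi}" f] by blast
  show ?thesis
  proof (intro exI allI)
    fix s
    obtain n :: int where n: "s + of_int n * (2 * pi) \<in> {0..<0 + 2 * pi}"
      using periodic_representative[of "2 * pi" s 0] by auto
    then show "f s \<le> f t" using t[of "s + of_int n * (2 * pi)"] periodic_int[of f "2 * pi" s n] per by auto
  qed
qed

lemma cos_less_cos:
  assumes "0 \<le> x" "x < y" "y < 2 * pi - x"
  shows "cos y < cos x"
proof (cases "y \<le> pi")
  case True
  then show ?thesis using assms by (intro cos_monotone_0_pi) auto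
next
  case False
  then have "cos (2 * pi - y) < cos x" using assms by (intro cos_monotone_0_pi) auto
  then show ?thesis by (simp add: cos_diff)
qed

section \<open>A diameter that balances a function with alternating extrema\<close>

text \<open>
  The difference \<open>H(t + \<pi>) - H(t)\<close> has opposite signs at a maximum and at a minimum of \<open>H\<close>.
\<close>
lemma antipodal_equal_between:
  fixes H :: "real \<Rightarrow> real"
  assumes cont: "continuous_on UNIV H"
    and range: "\<And>t. m \<le> H t \<and> H t \<le> M"
    and "p \<in> {s..t}" "q \<in> {s..t}" and "H p = M" "H q = m"
  obtains \<phi> where "\<phi> \<in> {s..t}" "H \<phi> = H (\<phi> + pi)"
proof -
  define d where "d = (\<lambda>t. H (t + pi) - H t)"
  have cont_d: "continuous_on S d" for S
    unfolding d_def
    by (intro continuous_intros continuous_on_subset[OF cont] continuous_on_compose2[OF cont]) auto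
  have d: "d p \<le> 0" "0 \<le> d q" using range assms(5,6) by (auto simp: d_def)
  have "\<exists>\<phi>\<in>{s..t}. d \<phi> = 0"
  proof (cases "p \<le> q")
    case True
    then show ?thesis
      using IVT'[of d p 0 q] d cont_d assms(3,4) by force
  next
    case False
    then show ?thesis
      using IVT2'[of d p 0 q] d cont_d assms(3,4) by force
  qed
  then show ?thesis using that by (auto simp: d_def)
qed

lemma value_between_extrema:
  fixes H :: "real \<Rightarrow> real"
  assumes cont: "continuous_on UNIV H"
    and "p \<in> {s..t}" "q \<in> {s..t}" and "H p = M" "H q = m" and "r \<in> {m..M}"
  shows "\<exists>\<psi>\<in>{s..t}. H \<psi> = r"
proof (cases "p \<le> q")
  case True
  then show ?thesis
    using IVT2'[of H q r p] assms continuous_on_subset[OF cont] by force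
next
  case False
  then show ?thesis
    using IVT'[of H q r p] assms continuous_on_subset[OF cont] by force
qed

text \<open>
  The line in direction \<open>\<phi>\<close> has to separate the two maxima as well as the two minima. After a cyclic
  relabelling the minima are at most \<open>\<pi>\<close> apart on the side of \<open>p\<^sub>0\<close>. If the maxima are at most \<open>\<pi>\<close>
  apart on the side of \<open>q\<^sub>1\<close>, every line between \<open>p\<^sub>0\<close> and \<open>q\<^sub>1\<close> does so; otherwise every line between
  \<open>q\<^sub>0\<close> and \<open>p\<^sub>0\<close> does. In both cases the interval joins a minimum to a maximum and hence contains an
  angle with equal antipodal values.
\<close>
lemma balanced_line:
  fixes H :: "real \<Rightarrow> real"
  assumes cont: "continuous_on UNIV H" and per: "\<And>t. H (t + 2 * pi) = H t"
    and range: "\<And>t. m \<le> H t \<and> H t \<le> M"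
    and order: "q\<^sub>0 < p\<^sub>0" "p\<^sub>0 < q\<^sub>1" "q\<^sub>1 < p\<^sub>1" "p\<^sub>1 < q\<^sub>0 + 2 * pi"
    and contact: "H q\<^sub>0 = m" "H p\<^sub>0 = M" "H q\<^sub>1 = m" "H p\<^sub>1 = M"
  obtains \<phi> where "H \<phi> = H (\<phi> + pi)"
    "\<forall>r\<in>{m..M}. \<exists>\<psi>\<in>{\<phi>..\<phi> + pi}. H \<psi> = r"
    "\<forall>r\<in>{m..M}. \<exists>\<psi>\<in>{\<phi> + pi..\<phi> + 2 * pi}. H \<psi> = r"
proof -
  define good where "good = (\<lambda>\<phi>. H \<phi> = H (\<phi> + pi) \<and>
    (\<forall>r\<in>{m..M}. \<exists>\<psi>\<in>{\<phi>..\<phi> + pi}. H \<psi> = r) \<and>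
    (\<forall>r\<in>{m..M}. \<exists>\<psi>\<in>{\<phi> + pi..\<phi> + 2 * pi}. H \<psi> = r))"
  have goodI: "good \<phi>"
    if hyps: "H \<phi> = H (\<phi> + pi)" "p \<in> {\<phi>..\<phi> + pi}" "q \<in> {\<phi>..\<phi> + pi}" "H p = M" "H q = m"
      "p' \<in> {\<phi> - pi..\<phi>}" "q' \<in> {\<phi> - pi..\<phi>}" "H p' = M" "H q' = m" for \<phi> p q p' q'
  proof -
    have "\<exists>\<psi>\<in>{\<phi>..\<phi> + pi}. H \<psi> = r" if "r \<in> {m..M}" for r
      using value_between_extrema[OF cont] that hyps by blast
    moreover have "\<exists>\<psi>\<in>{\<phi> + pi..\<phi> + 2 * pi}. H \<psi> = r" if r: "r \<in> {m..M}" for r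
    proof -
      obtain \<psi> where "\<psi> \<in> {\<phi> - pi..\<phi>}" "H \<psi> = r"
        using value_between_extrema[OF cont] r hyps by blast
      then show ?thesis using per[of \<psi>] by (intro bexI[of _ "\<psi> + 2 * pi"]) auto
    qed
    ultimately show ?thesis using hyps(1) by (simp add: good_def)
  qed
  have short: "\<exists>\<phi>. good \<phi>"
    if order: "q\<^sub>0 < p\<^sub>0" "p\<^sub>0 < q\<^sub>1" "q\<^sub>1 < p\<^sub>1" "p\<^sub>1 < q\<^sub>0 + 2 * pi"
      and contact: "H q\<^sub>0 = m" "H p\<^sub>0 = M" "H q\<^sub>1 = m" "H p\<^sub>1 = M"
      and "q\<^sub>1 - q\<^sub>0 \<le> pi" for q\<^sub>0 p\<^sub>0 q\<^sub>1 p\<^sub>1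
  proof (cases "p\<^sub>1 - p\<^sub>0 \<le> pi")
    case True
    obtain \<phi> where "\<phi> \<in> {p\<^sub>0..q\<^sub>1}" "H \<phi> = H (\<phi> + pi)"
      using antipodal_equal_between[OF cont range, of p\<^sub>0 p\<^sub>0 q\<^sub>1 q\<^sub>1] order contact by auto
    then have "good \<phi>"
      using order contact \<open>q\<^sub>1 - q\<^sub>0 \<le> pi\<close> True
      by (intro goodI[of \<phi> p\<^sub>1 q\<^sub>1 p\<^sub>0 q\<^sub>0]) auto
    then show ?thesis ..
  next
    case False
    obtain \<phi> where "\<phi> \<in> {q\<^sub>0..p\<^sub>0}" "H \<phi> = H (\<phi> + pi)"
      using antipodal_equal_between[OF cont range, of p\<^sub>0 q\<^sub>0 p\<^sub>0 q\<^sub>0] order contact by auto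
    then have "good \<phi>"
      using order contact \<open>q\<^sub>1 - q\<^sub>0 \<le> pi\<close> False per[of "p\<^sub>1 - 2 * pi"]
      by (intro goodI[of \<phi> p\<^sub>0 q\<^sub>1 "p\<^sub>1 - 2 * pi" q\<^sub>0]) auto
    then show ?thesis ..
  qed
  have "\<exists>\<phi>. good \<phi>"
  proof (cases "q\<^sub>1 - q\<^sub>0 \<le> pi")
    case True
    then show ?thesis using short[OF order contact] by blast
  next
    case False
    then show ?thesis
      using short[of q\<^sub>1 p\<^sub>1 "q\<^sub>0 + 2 * pi" "p\<^sub>0 + 2 * pi"] order contact per by simp
  qed
  then show ?thesis using that by (auto simp: good_def)
qed

section \<open>The support function of a planar convex body\<close>

definition rot :: "real^2 \<Rightarrow> real^2" where
  "rot v = vector [- (v$2), v$1]"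

lemma rot_nth [simp]: "rot v $ 1 = - (v$2)" "rot v $ 2 = v$1"
  by (simp_all add: rot_def)

lemma rot_rot [simp]: "rot (rot v) = - v"
  by (simp add: vec_eq_iff forall_2)

lemma bounded_linear_rot: "bounded_linear rot"
  unfolding linear_conv_bounded_linear[symmetric]
  by (rule linearI) (simp_all add: vec_eq_iff forall_2)

lemma orthonormal_rot:
  fixes a b :: "real^2"
  assumes "norm a = 1" "norm b = 1" "a \<bullet> b = 0"
  shows "b = rot a \<or> b = - rot a"
proof -
  have a: "a$1 * a$1 + a$2 * a$2 = 1" and b: "b$1 * b$1 + b$2 * b$2 = 1"
    and ab: "a$1 * b$1 + a$2 * b$2 = 0"
    using assms by (auto simp: norm_eq_1 inner_vec_def sum_2)
  define d where "d = a$1 * b$2 - a$2 * b$1"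
  have "b$1 = - d * a$2" "b$2 = d * a$1"
    using a ab unfolding d_def by algebra+
  moreover have "d * d = 1" using a b ab unfolding d_def by algebra
  then have "d = 1 \<or> d = -1" by (simp add: square_eq_1_iff)
  ultimately show ?thesis by (auto simp: vec_eq_iff forall_2)
qed

text \<open>
  The last term is the same for \<open>b\<close> and \<open>- b\<close>, which reduces the claim to \<open>b = rot a\<close>, a computation
  in coordinates.
\<close>
lemma orthonormal_expansion:
  fixes a b :: "real^2"
  assumes "norm a = 1" "norm b = 1" "a \<bullet> b = 0"
  shows "x = (x \<bullet> a) *\<^sub>R a + (x \<bullet> b) *\<^sub>R b"
proof -
  have a: "a$1 * a$1 + a$2 * a$2 = 1"
    using assms by (auto simp: norm_eq_1 inner_vec_def sum_2)
  have "x$1 = (x$1 * a$1 + x$2 * a$2) * a$1 + (x$1 * - a$2 + x$2 * a$1) * - a$2"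
       "x$2 = (x$1 * a$1 + x$2 * a$2) * a$2 + (x$1 * - a$2 + x$2 * a$1) * a$1"
    using a by algebra+
  then have "x = (x \<bullet> a) *\<^sub>R a + (x \<bullet> rot a) *\<^sub>R rot a"
    by (simp add: vec_eq_iff forall_2 inner_vec_def sum_2)
  then show ?thesis using orthonormal_rot[OF assms] by auto
qed

text \<open>
  The frame is arbitrary, of either orientation: it will consist of outward normal and tangent at one
  point of the curve, and the curve may run either way round.
\<close>
locale framed_body =
  fixes K :: "(real^2) set" and c a b :: "real^2"
  assumes compact_K: "compact K" and convex_K: "convex K" and K_ne: "K \<noteq> {}"
    and a: "norm a = 1" and b: "norm b = 1" and ab: "a \<bullet> b = 0"
begin

definition E :: "real \<Rightarrow> real^2" where "E t = cos t *\<^sub>R a + sin t *\<^sub>R b"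

definition H :: "real \<Rightarrow> real" where "H t = (SUP x\<in>K. (x - c) \<bullet> E t)"

lemma E_inner: "E s \<bullet> E t = cos (s - t)"
proof -
  have "b \<bullet> a = 0" using ab by (simp add: inner_commute)
  then show ?thesis
    using a b ab by (simp add: E_def inner_add_left inner_add_right norm_eq_1 cos_diff)
qed

lemma E_norm [simp]: "norm (E t) = 1"
  by (simp add: norm_eq_1 E_inner)

lemma E_periodic [simp]: "E (t + 2 * pi) = E t"
  by (simp add: E_def)

lemma E_cont: "continuous_on S E"
  unfolding E_def by (intro continuous_intros)

lemma polar_coordinates: "\<exists>t. x = norm x *\<^sub>R E t"
proof (cases "x = 0")
  case False
  define y where "y = x /\<^sub>R norm x"
  have y: "y = (y \<bullet> a) *\<^sub>R a + (y \<bullet> b) *\<^sub>R b" by (rule orthonormal_expansion[OF a b ab])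
  have "norm y = 1" using False by (simp add: y_def)
  then have "y \<bullet> y = 1" by (simp add: norm_eq_1)
  then have "(y \<bullet> a)\<^sup>2 + (y \<bullet> b)\<^sup>2 = 1"
    using arg_cong[OF y, of "\<lambda>z. y \<bullet> z"] by (simp add: inner_add_right power2_eq_square)
  then obtain t where t: "y \<bullet> a = cos t" "y \<bullet> b = sin t" using sincos_total_2pi by metis
  have "y = E t" unfolding E_def using y unfolding t .
  then have "x /\<^sub>R norm x = E t" by (simp only: y_def)
  then have "norm x *\<^sub>R E t = norm x *\<^sub>R (x /\<^sub>R norm x)" by (simp only:)
  also have "\<dots> = x" using False by simp
  finally have "x = norm x *\<^sub>R E t" by (rule sym)
  then show ?thesis by (rule exI)
qed simp

lemma H_attained: "\<exists>x\<in>K. (x - c) \<bullet> E t = H t \<and> (\<forall>y\<in>K. (y - c) \<bullet> E t \<le> H t)"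
proof -
  have "continuous_on K (\<lambda>x. (x - c) \<bullet> E t)" by (intro continuous_intros)
  then obtain x where x: "x \<in> K" "\<And>y. y \<in> K \<Longrightarrow> (y - c) \<bullet> E t \<le> (x - c) \<bullet> E t"
    using continuous_attains_sup[OF compact_K K_ne] by blast
  then have "H t = (x - c) \<bullet> E t"
    unfolding H_def by (intro cSup_eq_maximum) auto
  with x show ?thesis by auto
qed

lemma H_upper: "x \<in> K \<Longrightarrow> (x - c) \<bullet> E t \<le> H t"
  using H_attained by blast

lemma H_eqI: "x \<in> K \<Longrightarrow> (\<And>y. y \<in> K \<Longrightarrow> y \<bullet> E t \<le> x \<bullet> E t) \<Longrightarrow> H t = (x - c) \<bullet> E t"
  unfolding H_def by (rule cSup_eq_maximum) (auto simp: inner_diff_left)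

lemma H_periodic [simp]: "H (t + 2 * pi) = H t"
  by (simp add: H_def)

lemma H_cont: "continuous_on S H"
proof -
  obtain R where R: "\<And>x. x \<in> K \<Longrightarrow> norm (x - c) \<le> R" 
    using compact_imp_bounded[OF compact_K] bounded_any_center[of K c] by (auto simp: dist_norm norm_minus_commute)
  have R0: "0 \<le> R" using R K_ne norm_ge_zero order_trans by blast
  have le: "H s \<le> H t + R * norm (E s - E t)" for s t
  proof -
    obtain x where x: "x \<in> K" "(x - c) \<bullet> E s = H s" using H_attained by blast
    have "(x - c) \<bullet> (E s - E t) \<le> norm (x - c) * norm (E s - E t)" by (rule norm_cauchy_schwarz)
    also have "\<dots> \<le> R * norm (E s - E t)" by (intro mult_right_mono R x) simp
    finally show ?thesis using x H_upper[of x t] by (simp add: inner_diff_right)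
  qed
  show ?thesis
    unfolding continuous_on
  proof
    fix t assume "t \<in> S"
    have "((\<lambda>s. R * norm (E s - E t)) \<longlongrightarrow> R * norm (E t - E t)) (at t within S)"
      using E_cont[of S] \<open>t \<in> S\<close> by (intro tendsto_intros) (auto simp: continuous_on)
    then have lim: "((\<lambda>s. R * norm (E s - E t)) \<longlongrightarrow> 0) (at t within S)" by simp
    have "norm (H s - H t) \<le> R * norm (E s - E t)" for s
      using le[of s t] le[of t s] norm_minus_commute[of "E s" "E t"] by simp
    then have "((\<lambda>s. H s - H t) \<longlongrightarrow> 0) (at t within S)"
      by (intro Lim_null_comparison[OF _ lim] always_eventually allI)
    then show "(H \<longlongrightarrow> H t) (at t within S)" by (rule LIM_zero_cancel)
  qed
qed

lemma outer_disk_iff: "K \<subseteq> cball (c + w) R \<longleftrightarrow> (\<forall>t. H t - w \<bullet> E t \<le> R)"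
proof
  assume sub: "K \<subseteq> cball (c + w) R"
  show "\<forall>t. H t - w \<bullet> E t \<le> R"
  proof
    fix t
    obtain x where x: "x \<in> K" "(x - c) \<bullet> E t = H t" using H_attained by blast
    have "H t - w \<bullet> E t = (x - (c + w)) \<bullet> E t" using x by (simp add: inner_diff_left inner_add_left)
    also have "\<dots> \<le> norm (x - (c + w)) * norm (E t)" by (rule norm_cauchy_schwarz)
    also have "\<dots> \<le> R" using sub x by (auto simp: dist_norm norm_minus_commute)
    finally show "H t - w \<bullet> E t \<le> R" .
  qed
next
  assume le: "\<forall>t. H t - w \<bullet> E t \<le> R"
  show "K \<subseteq> cball (c + w) R"
  proof
    fix x assume x: "x \<in> K"
    obtain t where t: "x - (c + w) = norm (x - (c + w)) *\<^sub>R E t" using polar_coordinates by blast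
    have "norm (x - (c + w)) = (x - (c + w)) \<bullet> E t"
      by (subst (2) t) (simp add: E_inner)
    also have "\<dots> \<le> H t - w \<bullet> E t"
      using H_upper[OF x, of t] by (simp add: inner_diff_left inner_add_left)
    also have "\<dots> \<le> R" using le by blast
    finally show "x \<in> cball (c + w) R" by (simp add: dist_norm norm_minus_commute)
  qed
qed

lemma inner_disk_iff:
  assumes "0 \<le> r"
  shows "cball (c + w) r \<subseteq> K \<longleftrightarrow> (\<forall>t. r \<le> H t - w \<bullet> E t)"
proof
  assume sub: "cball (c + w) r \<subseteq> K"
  show "\<forall>t. r \<le> H t - w \<bullet> E t"
  proof
    fix t
    have "c + w + r *\<^sub>R E t \<in> K" using sub assms by (auto simp: dist_norm)
    from H_upper[OF this, of t] show "r \<le> H t - w \<bullet> E t"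
      by (simp add: inner_add_left inner_diff_left E_inner)
  qed
next
  assume ge: "\<forall>t. r \<le> H t - w \<bullet> E t"
  show "cball (c + w) r \<subseteq> K"
  proof (rule subsetI, rule ccontr)
    fix y assume y: "y \<in> cball (c + w) r" "y \<notin> K"
    obtain v d where vd: "v \<bullet> y < d" "\<And>x. x \<in> K \<Longrightarrow> v \<bullet> x > d"
      using separating_hyperplane_closed_point[OF convex_K compact_imp_closed[OF compact_K] y(2)]
      by auto
    have "v \<noteq> 0" using vd K_ne by fastforce
    obtain t where t: "- v = norm v *\<^sub>R E t" using polar_coordinates[of "- v"] by auto
    obtain x where x: "x \<in> K" "(x - c) \<bullet> E t = H t" using H_attained by blast
    have "v \<bullet> y < v \<bullet> x" using vd(1) vd(2)[OF x(1)] by linarith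
    then have "(x - y) \<bullet> v > 0" by (simp add: inner_diff_left inner_commute[of v])
    then have "norm v * ((x - y) \<bullet> E t) < 0"
      using arg_cong[OF t, of "\<lambda>z. (x - y) \<bullet> z"] by simp
    then have "(x - y) \<bullet> E t < 0" using \<open>v \<noteq> 0\<close> by (simp add: mult_less_0_iff)
    moreover have "(y - (c + w)) \<bullet> E t \<le> r"
      using norm_cauchy_schwarz[of "y - (c + w)" "E t"] y(1) by (simp add: dist_norm norm_minus_commute)
    ultimately show False
      using ge[rule_format, of t] x(2) by (simp add: inner_diff_left inner_add_left)
  qed
qed

text \<open>
  Moving the centre by \<open>w\<close> subtracts the first harmonic \<open>w \<bullet> E t\<close> from the support function, so
  a thinner annulus is a first harmonic that leaves \<open>H\<close> with a smaller oscillation.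
\<close>
lemma bounding_annulus_iff:
  "bounding_annulus K (c + w) r R \<longleftrightarrow>
    0 \<le> r \<and> r \<le> R \<and> (\<forall>t. r \<le> H t - w \<bullet> E t \<and> H t - w \<bullet> E t \<le> R)"
  using inner_disk_iff[of r w] outer_disk_iff[of w R] by (auto simp: bounding_annulus_def)

end

section \<open>Contact directions of the minimal annulus\<close>

context framed_body
begin

lemma E_inner_cont: "continuous_on S (\<lambda>t. v \<bullet> E t)"
  by (intro continuous_intros E_cont)

lemma support_bounds:
  assumes "bounding_annulus K c m M"
  shows "m \<le> H t" "H t \<le> M"
  using assms bounding_annulus_iff[of 0 m M] by auto

text \<open>
  Moving the centre by \<open>\<epsilon> v\<close> lowers \<open>H\<close> by more than \<open>\<epsilon> \<alpha>\<close> near the outer contacts and by less near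
  the inner ones, and elsewhere \<open>H\<close> stays away from its extreme values. So the new annulus lies
  strictly between the radii \<open>m - \<epsilon> \<alpha>\<close> and \<open>M - \<epsilon> \<alpha>\<close>. The premise \<open>room\<close> keeps its inner radius
  nonnegative.
\<close>
lemma no_separation:
  assumes min: "minimal_annulus K c m M"
    and outer: "\<And>t. H t = M \<Longrightarrow> \<alpha> < v \<bullet> E t"
    and inner: "\<And>t. H t = m \<Longrightarrow> v \<bullet> E t < \<alpha>"
    and room: "0 < m \<or> \<alpha> \<le> 0"
  shows False
proof -
  have bound: "bounding_annulus K c m M"
    and least: "\<And>w r R. bounding_annulus K (c + w) r R \<Longrightarrow> M - m \<le> R - r"
    using min by (auto simp: minimal_annulus_def)
  have m0: "0 \<le> m" using bound by (simp add: bounding_annulus_def)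
  note range = support_bounds[OF bound]
  have "H t < M" if "v \<bullet> E t \<le> \<alpha>" for t
    using range(2)[of t] outer[of t] that by linarith
  then have "0 < M - H t" if "v \<bullet> E t - \<alpha> \<le> 0" for t using that by simp
  then obtain \<delta>\<^sub>1 where \<delta>\<^sub>1: "\<delta>\<^sub>1 > 0" "\<And>t. v \<bullet> E t - \<alpha> \<le> 0 \<Longrightarrow> \<delta>\<^sub>1 \<le> M - H t"
    by (rule periodic_gap[of "\<lambda>t. v \<bullet> E t - \<alpha>" "\<lambda>t. M - H t", rotated 4])
      (simp_all add: continuous_on_diff continuous_on_const E_inner_cont H_cont)
  have "m < H t" if "\<alpha> \<le> v \<bullet> E t" for t
    using range(1)[of t] inner[of t] that by linarith
  then have "0 < H t - m" if "\<alpha> - v \<bullet> E t \<le> 0" for t using that by simp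
  then obtain \<delta>\<^sub>2 where \<delta>\<^sub>2: "\<delta>\<^sub>2 > 0" "\<And>t. \<alpha> - v \<bullet> E t \<le> 0 \<Longrightarrow> \<delta>\<^sub>2 \<le> H t - m"
    by (rule periodic_gap[of "\<lambda>t. \<alpha> - v \<bullet> E t" "\<lambda>t. H t - m", rotated 4])
      (simp_all add: continuous_on_diff continuous_on_const E_inner_cont H_cont)
  define \<delta> where "\<delta> = min \<delta>\<^sub>1 \<delta>\<^sub>2"
  have \<delta>: "\<delta> > 0" "\<delta> \<le> \<delta>\<^sub>1" "\<delta> \<le> \<delta>\<^sub>2" using \<delta>\<^sub>1 \<delta>\<^sub>2 by (auto simp: \<delta>_def)
  define s where "s = norm v + \<bar>\<alpha>\<bar> + 1"
  have s: "s > 0" by (simp add: s_def add_nonneg_pos)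
  \<comment> \<open>The step must be small compared with the gap \<open>\<delta>\<close>, and for \<open>\<alpha> > 0\<close> also compared with \<open>m\<close>.\<close>
  obtain \<epsilon> where \<epsilon>: "\<epsilon> > 0" "\<epsilon> * s \<le> \<delta>" "0 \<le> m - \<epsilon> * \<alpha>"
  proof (cases "\<alpha> \<le> 0")
    case True
    show ?thesis
    proof (rule that[of "\<delta> / s"])
      have "\<delta> / s * \<alpha> \<le> 0" using \<delta> s True by (intro mult_nonneg_nonpos) auto
      then show "0 \<le> m - \<delta> / s * \<alpha>" using m0 by linarith
    qed (use \<delta> s in auto)
  next
    case False
    show ?thesis
    proof (rule that[of "min (\<delta> / s) (m / \<alpha>)"])
      have "min (\<delta> / s) (m / \<alpha>) * s \<le> \<delta> / s * s" using s by (intro mult_right_mono) auto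
      then show "min (\<delta> / s) (m / \<alpha>) * s \<le> \<delta>" using s by simp
      have "min (\<delta> / s) (m / \<alpha>) * \<alpha> \<le> m / \<alpha> * \<alpha>" using False by (intro mult_right_mono) auto
      then show "0 \<le> m - min (\<delta> / s) (m / \<alpha>) * \<alpha>" using False by simp
    qed (use \<delta> s False room in auto)
  qed
  define G where "G = (\<lambda>t. H t - (\<epsilon> *\<^sub>R v) \<bullet> E t)"
  have G: "G t = H t - \<epsilon> * (v \<bullet> E t)" for t by (simp add: G_def)
  have vE: "\<epsilon> * (v \<bullet> E t) \<le> \<epsilon> * norm v" "- (\<epsilon> * norm v) \<le> \<epsilon> * (v \<bullet> E t)" for t
  proof -
    have "\<bar>v \<bullet> E t\<bar> \<le> norm v" using Cauchy_Schwarz_ineq2[of v "E t"] by simp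
    then have "\<epsilon> * \<bar>v \<bullet> E t\<bar> \<le> \<epsilon> * norm v" using \<epsilon>(1) by simp
    then have "\<bar>\<epsilon> * (v \<bullet> E t)\<bar> \<le> \<epsilon> * norm v" using \<epsilon>(1) by (simp add: abs_mult)
    then show "\<epsilon> * (v \<bullet> E t) \<le> \<epsilon> * norm v" "- (\<epsilon> * norm v) \<le> \<epsilon> * (v \<bullet> E t)" by linarith+
  qed
  have "\<epsilon> * norm v + \<epsilon> * \<bar>\<alpha>\<bar> + \<epsilon> \<le> \<delta>" using \<epsilon>(2) by (simp add: s_def algebra_simps)
  moreover have "\<epsilon> * \<bar>\<alpha>\<bar> = \<bar>\<epsilon> * \<alpha>\<bar>" using \<epsilon>(1) by (simp add: abs_mult)
  ultimately have small: "\<epsilon> * norm v + \<bar>\<epsilon> * \<alpha>\<bar> < \<delta>" using \<epsilon>(1) by linarith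
  have upper: "G t < M - \<epsilon> * \<alpha>" for t
  proof (cases "v \<bullet> E t \<le> \<alpha>")
    case True
    then have "H t \<le> M - \<delta>" using \<delta>\<^sub>1(2)[of t] \<delta> by linarith
    then show ?thesis using vE[of t] small unfolding G by linarith
  next
    case False
    then have "\<epsilon> * \<alpha> < \<epsilon> * (v \<bullet> E t)" using \<epsilon>(1) by simp
    then show ?thesis using range(2)[of t] unfolding G by linarith
  qed
  have lower: "m - \<epsilon> * \<alpha> < G t" for t
  proof (cases "\<alpha> \<le> v \<bullet> E t")
    case True
    then have "m + \<delta> \<le> H t" using \<delta>\<^sub>2(2)[of t] \<delta> by linarith
    then show ?thesis using vE[of t] small unfolding G by linarith
  next
    case False
    then have "\<epsilon> * (v \<bullet> E t) < \<epsilon> * \<alpha>" using \<epsilon>(1) by simp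
    then show ?thesis using range(1)[of t] unfolding G by linarith
  qed
  have contG: "continuous_on UNIV G" unfolding G_def
    by (intro continuous_intros E_inner_cont H_cont)
  have perG: "G (t + 2 * pi) = G t" for t by (simp add: G_def)
  obtain t\<^sub>1 where t\<^sub>1: "\<And>t. G t \<le> G t\<^sub>1"
    using periodic_attains_sup[OF contG perG] by blast
  have "continuous_on UNIV (\<lambda>t. - G t)" using contG by (intro continuous_intros)
  from periodic_attains_sup[OF this] perG
  obtain t\<^sub>2 where t\<^sub>2: "\<And>t. - G t \<le> - G t\<^sub>2" by auto
  have "bounding_annulus K (c + \<epsilon> *\<^sub>R v) (G t\<^sub>2) (G t\<^sub>1)"
    unfolding bounding_annulus_iff
  proof (intro conjI allI)
    show "0 \<le> G t\<^sub>2" using lower[of t\<^sub>2] \<epsilon>(3) by linarith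
    show "G t\<^sub>2 \<le> G t\<^sub>1" by (rule t\<^sub>1)
    show "G t\<^sub>2 \<le> H t - (\<epsilon> *\<^sub>R v) \<bullet> E t" for t using t\<^sub>2[of t] by (simp add: G_def)
    show "H t - (\<epsilon> *\<^sub>R v) \<bullet> E t \<le> G t\<^sub>1" for t using t\<^sub>1[of t] by (simp add: G_def)
  qed
  from least[OF this] show False using upper[of t\<^sub>1] lower[of t\<^sub>2] by linarith
qed

lemma contact_exists:
  assumes min: "minimal_annulus K c m M"
  shows "\<exists>p. H p = M" "\<exists>q. H q = m"
proof -
  have bound: "bounding_annulus K c m M"
    and least: "\<And>r R. bounding_annulus K c r R \<Longrightarrow> M - m \<le> R - r"
    using min by (auto simp: minimal_annulus_def)
  note range = support_bounds[OF bound]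
  have m0: "0 \<le> m" using bound by (simp add: bounding_annulus_def)
  obtain p where p: "\<And>t. H t \<le> H p"
    using periodic_attains_sup[OF H_cont H_periodic] by blast
  have "continuous_on UNIV (\<lambda>t. - H t)" by (intro continuous_intros H_cont)
  from periodic_attains_sup[OF this]
  obtain q where q: "\<And>t. - H t \<le> - H q" by auto
  have "bounding_annulus K (c + 0) (H q) (H p)"
    unfolding bounding_annulus_iff using p q range(1)[of q] m0 by auto
  then have "M - m \<le> H p - H q" using least by simp
  then have "H p = M" "H q = m" using range(2)[of p] range(1)[of q] by linarith+
  then show "\<exists>p. H p = M" "\<exists>q. H q = m" by blast+
qed

text \<open>
  Start at an inner contact and let \<open>a\<close> and \<open>b\<close> be the first and the last outer contact of the
  following turn. Without an inner contact in between, the chord from \<open>a\<close> to \<open>b\<close> would separate the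
  outer from the inner contacts.
\<close>
lemma alternating_contacts:
  assumes min: "minimal_annulus K c m M" and "0 < m" "m < M"
  obtains q\<^sub>0 p\<^sub>0 q\<^sub>1 p\<^sub>1 where "q\<^sub>0 < p\<^sub>0" "p\<^sub>0 < q\<^sub>1" "q\<^sub>1 < p\<^sub>1" "p\<^sub>1 < q\<^sub>0 + 2 * pi"
    "H q\<^sub>0 = m" "H p\<^sub>0 = M" "H q\<^sub>1 = m" "H p\<^sub>1 = M"
proof -
  note range = support_bounds[of m M] and per = periodic_int[of H "2 * pi", OF H_periodic]
  have bound: "bounding_annulus K c m M" using min by (simp add: minimal_annulus_def)
  obtain q\<^sub>0 where q\<^sub>0: "H q\<^sub>0 = m" using contact_exists[OF min] by blast
  define P where "P = {q\<^sub>0..q\<^sub>0 + 2 * pi} \<inter> {t. H t = M}"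
  have "compact P"
    unfolding P_def by (intro compact_Int_closed closed_Collect_eq H_cont continuous_intros) auto
  have rep: "\<exists>t'\<in>{q\<^sub>0..<q\<^sub>0 + 2 * pi}. H t' = H t \<and> (\<forall>v. v \<bullet> E t' = v \<bullet> E t)" for t
  proof -
    obtain n :: int where n: "t + of_int n * (2 * pi) \<in> {q\<^sub>0..<q\<^sub>0 + 2 * pi}"
      using periodic_representative[of "2 * pi" t q\<^sub>0] by auto
    then show ?thesis
      using per[of t n] periodic_int[of E "2 * pi" t n] by (intro bexI[OF _ n]) auto
  qed
  have "P \<noteq> {}"
  proof -
    obtain p where "H p = M" using contact_exists[OF min] by blast
    with rep[of p] show ?thesis unfolding P_def by force
  qed
  obtain a where a: "a \<in> P" "\<And>t. t \<in> P \<Longrightarrow> a \<le> t"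
    using compact_attains_inf[OF \<open>compact P\<close> \<open>P \<noteq> {}\<close>] by blast
  obtain b where b: "b \<in> P" "\<And>t. t \<in> P \<Longrightarrow> t \<le> b"
    using compact_attains_sup[OF \<open>compact P\<close> \<open>P \<noteq> {}\<close>] by blast
  have "H a = M" "H b = M" using a b by (auto simp: P_def)
  then have "a \<noteq> q\<^sub>0" "b \<noteq> q\<^sub>0 + 2 * pi" using q\<^sub>0 \<open>m < M\<close> by auto
  then have ab: "q\<^sub>0 < a" "a \<le> b" "b < q\<^sub>0 + 2 * pi"
    using a b by (auto simp: P_def)
  have "\<exists>q. H q = m \<and> a \<le> q \<and> q \<le> b"
  proof (rule ccontr)
    assume none: "\<nexists>q. H q = m \<and> a \<le> q \<and> q \<le> b"
    \<comment> \<open>The direction of the midpoint of the arc, and the signed distance of its chord from the centre.\<close>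
    define v where "v = E ((a + b) / 2)"
    define \<beta> where "\<beta> = cos ((b - a) / 2)"
    have vE: "v \<bullet> E t = cos \<bar>(a + b) / 2 - t\<bar>" for t by (simp add: v_def E_inner)
    have outer: "\<beta> \<le> v \<bullet> E t" if t: "H t = M" for t
    proof -
      obtain t' where t': "t' \<in> {q\<^sub>0..<q\<^sub>0 + 2 * pi}" "H t' = H t" "v \<bullet> E t' = v \<bullet> E t"
        using rep by blast
      then have "t' \<in> P" using t by (auto simp: P_def)
      then have "a \<le> t'" "t' \<le> b" using a b by auto
      then have "\<bar>(a + b) / 2 - t'\<bar> \<le> (b - a) / 2" unfolding abs_le_iff by (simp add: field_simps)
      then have "\<beta> \<le> v \<bullet> E t'" unfolding vE \<beta>_def using ab
        by (intro cos_monotone_0_pi_le) auto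
      then show ?thesis using t' by simp
    qed
    have inner: "v \<bullet> E t < \<beta>" if t: "H t - m \<le> 0" for t
    proof -
      obtain t' where t': "t' \<in> {q\<^sub>0..<q\<^sub>0 + 2 * pi}" "H t' = H t" "v \<bullet> E t' = v \<bullet> E t"
        using rep by blast
      have "H t = m" using t range(1)[OF bound, of t] by linarith
      then have "H t' = m" using t' by simp
      then have "\<not> (a \<le> t' \<and> t' \<le> b)" using none by blast
      then have "t' < a \<or> b < t'" by linarith
      then have "b - a < \<bar>a + b - 2 * t'\<bar>" by linarith
      then have "(b - a) / 2 < \<bar>(a + b) / 2 - t'\<bar>" by (simp add: abs_if field_simps split: if_splits)
      moreover have "\<bar>(a + b) / 2 - t'\<bar> < 2 * pi - (b - a) / 2"
        using ab t'(1) unfolding abs_less_iff by (simp add: field_simps)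
      ultimately have "v \<bullet> E t' < \<beta>" unfolding vE \<beta>_def using ab
        by (intro cos_less_cos) auto
      then show ?thesis using t' by simp
    qed
    have "0 < \<beta> - v \<bullet> E t" if "H t - m \<le> 0" for t using inner[OF that] by simp
    then obtain \<delta> where \<delta>: "\<delta> > 0" "\<And>t. H t - m \<le> 0 \<Longrightarrow> \<delta> \<le> \<beta> - v \<bullet> E t"
      by (rule periodic_gap[of "\<lambda>t. H t - m" "\<lambda>t. \<beta> - v \<bullet> E t", rotated 4])
        (simp_all add: continuous_on_diff continuous_on_const E_inner_cont H_cont)
    show False
    proof (rule no_separation[OF min])
      show "\<beta> - \<delta> / 2 < v \<bullet> E t" if "H t = M" for t using outer[OF that] \<delta>(1) by linarith
      show "v \<bullet> E t < \<beta> - \<delta> / 2" if "H t = m" for t using \<delta>(1) \<delta>(2)[of t] that by linarith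
      show "0 < m \<or> \<beta> - \<delta> / 2 \<le> 0" using \<open>0 < m\<close> ..
    qed
  qed
  then obtain q\<^sub>1 where q\<^sub>1: "H q\<^sub>1 = m" "a \<le> q\<^sub>1" "q\<^sub>1 \<le> b" by blast
  moreover have "a \<noteq> q\<^sub>1" "q\<^sub>1 \<noteq> b" using q\<^sub>1 \<open>H a = M\<close> \<open>H b = M\<close> \<open>m < M\<close> by auto
  ultimately show ?thesis using that[of q\<^sub>0 a q\<^sub>1 b] ab q\<^sub>0 \<open>H a = M\<close> \<open>H b = M\<close> by simp
qed

text \<open>
  For inner radius \<open>0\<close> the centre is a boundary point, with a single normal direction \<open>E q\<close> by
  smoothness. As \<open>K\<close> lies behind the supporting line there, every outer contact makes an angle of at
  least \<open>\<pi> / 2\<close> with \<open>E q\<close>, and moving the centre inwards would improve the annulus.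
\<close>
lemma inner_radius_pos:
  assumes min: "minimal_annulus K c m M" and "0 < M"
    and smooth: "\<And>s t. H s = 0 \<Longrightarrow> H t = 0 \<Longrightarrow> E s = E t"
  shows "0 < m"
proof (rule ccontr)
  assume "\<not> 0 < m"
  have bound: "bounding_annulus K c m M" using min by (simp add: minimal_annulus_def)
  with \<open>\<not> 0 < m\<close> have "m = 0" by (simp add: bounding_annulus_def)
  obtain q where q: "H q = 0" using contact_exists[OF min] \<open>m = 0\<close> by blast
  show False
  proof (rule no_separation[OF min, of "- 1 / 2" "- E q"])
    fix t assume t: "H t = M"
    obtain x where x: "x \<in> K" "(x - c) \<bullet> E t = M" using H_attained[of t] t by auto
    have "norm (x - c) \<le> M" using bound x(1)
      by (auto simp: bounding_annulus_def dist_norm norm_minus_commute)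
    then have "(norm (x - c))\<^sup>2 \<le> M\<^sup>2" by (intro power_mono) auto
    moreover define y where "y = x - c"
    moreover have "(norm (y - M *\<^sub>R E t))\<^sup>2 = (norm y)\<^sup>2 - 2 * M * (y \<bullet> E t) + M\<^sup>2"
    proof -
      have "E t \<bullet> E t = 1" by (simp add: E_inner)
      then show ?thesis
        unfolding power2_norm_eq_inner inner_diff_left inner_diff_right inner_commute[of "M *\<^sub>R E t" y]
        by (simp add: power2_eq_square)
    qed
    ultimately have "(norm (y - M *\<^sub>R E t))\<^sup>2 \<le> 0" using x(2) by (simp add: power2_eq_square)
    then have "x - c = M *\<^sub>R E t" by (simp add: y_def)
    then have "M * (E t \<bullet> E q) \<le> 0" using H_upper[OF x(1), of q] q by simp
    then have "E q \<bullet> E t \<le> 0" using \<open>0 < M\<close> by (simp add: mult_le_0_iff inner_commute)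
    then show "- 1 / 2 < - E q \<bullet> E t" by simp
  next
    fix t assume "H t = m"
    with \<open>m = 0\<close> q have "E t = E q" by (intro smooth) simp_all
    then show "- E q \<bullet> E t < - 1 / 2" by (simp add: E_inner)
  qed simp
qed

lemma balanced_direction:
  assumes min: "minimal_annulus K c m M"
    and smooth: "\<And>s t. H s = 0 \<Longrightarrow> H t = 0 \<Longrightarrow> E s = E t"
  obtains \<phi> where "H \<phi> = H (\<phi> + pi)"
    "\<forall>r\<in>{m..M}. \<exists>\<psi>\<in>{\<phi>..\<phi> + pi}. H \<psi> = r"
    "\<forall>r\<in>{m..M}. \<exists>\<psi>\<in>{\<phi> + pi..\<phi> + 2 * pi}. H \<psi> = r"
proof -
  have bound: "bounding_annulus K c m M" using min by (simp add: minimal_annulus_def)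
  note range = support_bounds[OF bound]
  have mM: "0 \<le> m" "m \<le> M" using bound by (simp_all add: bounding_annulus_def)
  show ?thesis
  proof (cases "m = M")
    case True
    then have "H t = M" for t using range[of t] by simp
    then show ?thesis using True by (intro that[of 0]) (auto intro!: bexI[of _ pi])
  next
    case False
    then have "m < M" "0 < M" using mM by auto
    moreover have "0 < m" by (rule inner_radius_pos[OF min \<open>0 < M\<close> smooth])
    ultimately obtain q\<^sub>0 p\<^sub>0 q\<^sub>1 p\<^sub>1 where alt: "q\<^sub>0 < p\<^sub>0" "p\<^sub>0 < q\<^sub>1" "q\<^sub>1 < p\<^sub>1" "p\<^sub>1 < q\<^sub>0 + 2 * pi"
        "H q\<^sub>0 = m" "H p\<^sub>0 = M" "H q\<^sub>1 = m" "H p\<^sub>1 = M"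
      using alternating_contacts[OF min] by blast
    have "m \<le> H t \<and> H t \<le> M" for t using range by simp
    then show ?thesis by (rule balanced_line[OF H_cont H_periodic _ alt]) (rule that)
  qed
qed

end

section \<open>Area and support function\<close>

text \<open>
  Prolonging the segment from \<open>c\<close> through \<open>x\<close> beyond \<open>K\<close>, one crosses the frontier.
\<close>
lemma bounded_subset_cone_of_frontier:
  fixes K :: "'a::euclidean_space set"
  assumes "bounded K" "x \<in> K" "x \<noteq> c"
  obtains y t where "y \<in> frontier K" "0 \<le> t" "t \<le> 1" "x = c + t *\<^sub>R (y - c)"
proof -
  obtain R where R: "\<And>y. y \<in> K \<Longrightarrow> dist c y \<le> R" 
    using \<open>bounded K\<close> bounded_any_center[of K c] by auto
  have d: "norm (x - c) > 0" using assms by simp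
  define n where "n = max 1 ((R + 1) / norm (x - c))"
  have n: "n \<ge> 1" and "(R + 1) / norm (x - c) \<le> n" by (simp_all add: n_def)
  then have "R + 1 \<le> n * norm (x - c)" using d by (simp add: field_simps)
  then have "R < dist c (c + n *\<^sub>R (x - c))" using n by (simp add: dist_norm)
  then have out: "c + n *\<^sub>R (x - c) \<notin> K" using R by force
  let ?S = "(\<lambda>u. c + u *\<^sub>R (x - c)) ` {1..n}"
  have "connected ?S" by (intro connected_continuous_image continuous_intros) auto
  moreover have "?S \<inter> K \<noteq> {}" using \<open>x \<in> K\<close> n by (force intro: image_eqI[of _ _ 1])
  moreover have "?S - K \<noteq> {}" using out n by force
  ultimately have "?S \<inter> frontier K \<noteq> {}" by (rule connected_Int_frontier)
  then obtain u where u: "1 \<le> u" "c + u *\<^sub>R (x - c) \<in> frontier K" by auto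
  then show ?thesis by (intro that[of "c + u *\<^sub>R (x - c)" "1 / u"]) auto
qed

lemma has_integral_product_rectangle:
  fixes h :: "real \<Rightarrow> real" and p q :: real
  assumes cont: "continuous_on {p..q} h" and nonneg: "\<And>s. s \<in> {p..q} \<Longrightarrow> 0 \<le> h s"
  shows "((\<lambda>y::real^2. y$1 * h (y$2)) has_integral (integral {p..q} h) / 2)
    (cbox (vector [0, p]) (vector [1, q]))"
proof -
  \<comment> \<open>Extended by zero, the integrand is a product of functions of one coordinate each.\<close>
  define g\<^sub>1 where "g\<^sub>1 = (\<lambda>x::real. if x \<in> {0..1} then x else 0)"
  define g\<^sub>2 where "g\<^sub>2 = (\<lambda>s. if s \<in> {p..q} then h s else 0)"
  define f where "f = (\<lambda>b::real^2. if b = axis 1 1 then g\<^sub>1 else g\<^sub>2)"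
  have "g\<^sub>1 = (\<lambda>x. indicator {0..1} x *\<^sub>R x)" "g\<^sub>2 = (\<lambda>s. indicator {p..q} s *\<^sub>R h s)"
    by (simp_all add: g\<^sub>1_def g\<^sub>2_def indicator_def fun_eq_iff)
  then have meas: "g\<^sub>1 \<in> borel_measurable borel" "g\<^sub>2 \<in> borel_measurable borel"
    using cont by (simp_all only: borel_measurable_continuous_on_indicator continuous_on_id
        atLeastAtMost_borel)
  have nn: "0 \<le> g\<^sub>1 x" "0 \<le> g\<^sub>2 x" for x using nonneg by (auto simp: g\<^sub>1_def g\<^sub>2_def)
  have "((\<lambda>x::real. x) has_integral (1\<^sup>2 / 2 - 0\<^sup>2 / 2)) {0..1}"
    by (rule fundamental_theorem_of_calculus)
      (auto simp flip: has_real_derivative_iff_has_vector_derivative intro!: derivative_eq_intros)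
  then have "(g\<^sub>1 has_integral 1 / 2) UNIV"
    unfolding g\<^sub>1_def by (subst has_integral_restrict_UNIV) simp
  then have I1: "(\<integral>\<^sup>+x. g\<^sub>1 x \<partial>lborel) = ennreal (1 / 2)"
    using nn_integral_has_integral_lborel[OF meas(1) nn(1)] by simp
  have "(h has_integral integral {p..q} h) {p..q}"
    using cont by (intro integrable_integral integrable_continuous_real)
  then have "(g\<^sub>2 has_integral integral {p..q} h) UNIV"
    unfolding g\<^sub>2_def by (subst has_integral_restrict_UNIV)
  then have I2: "(\<integral>\<^sup>+x. g\<^sub>2 x \<partial>lborel) = ennreal (integral {p..q} h)"
    using nn_integral_has_integral_lborel[OF meas(2) nn(2)] by simp
  have J: "0 \<le> integral {p..q} h"
    using nonneg by (intro integral_nonneg integrable_continuous_real cont) auto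
  have Basis: "Basis = {axis 1 1, axis 2 (1::real) :: real^2}"
    by (auto simp: Basis_vec_def UNIV_2)
  have ne: "axis 1 (1::real) \<noteq> (axis 2 1 :: real^2)" by (simp add: axis_eq_axis)
  have prod: "(\<Prod>b\<in>Basis. f b (y \<bullet> b)) = g\<^sub>1 (y$1) * g\<^sub>2 (y$2)" for y :: "real^2"
    unfolding Basis using ne by (simp add: f_def inner_axis)
  have "(\<lambda>y::real^2. y$i) \<in> borel_measurable borel" for i
    by (intro borel_measurable_continuous_onI continuous_intros)
  then have measF: "(\<lambda>y::real^2. g\<^sub>1 (y$1) * g\<^sub>2 (y$2)) \<in> borel_measurable borel"
    by (intro borel_measurable_times measurable_compose[OF _ meas(1)] measurable_compose[OF _ meas(2)])
  have "nn_integral lborel (\<lambda>y::real^2. ennreal (g\<^sub>1 (y$1) * g\<^sub>2 (y$2)))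
      = nn_integral lborel (\<lambda>y::real^2. \<Prod>b\<in>Basis. ennreal (f b (y \<bullet> b)))"
    using nn by (subst prod_ennreal) (simp_all add: prod, simp_all add: f_def)
  also have "\<dots> = (\<Prod>b\<in>Basis. (\<integral>\<^sup>+x. f b x \<partial>lborel))"
    using meas by (intro nn_integral_lborel_prod) (auto simp: f_def)
  also have "\<dots> = ennreal (1 / 2) * ennreal (integral {p..q} h)"
    unfolding Basis using ne by (simp add: f_def I1 I2)
  also have "\<dots> = ennreal (1 / 2 * integral {p..q} h)" using J by (intro ennreal_mult[symmetric]) simp_all
  also have "\<dots> = ennreal (integral {p..q} h / 2)" by simp
  finally have "((\<lambda>y::real^2. g\<^sub>1 (y$1) * g\<^sub>2 (y$2)) has_integral integral {p..q} h / 2) UNIV"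
    using measF J nn by (intro nn_integral_has_integral) simp_all
  moreover have "(\<lambda>y::real^2. g\<^sub>1 (y$1) * g\<^sub>2 (y$2))
      = (\<lambda>y. if y \<in> cbox (vector [0, p]) (vector [1, q]) then y$1 * h (y$2) else 0)"
    by (auto simp: fun_eq_iff g\<^sub>1_def g\<^sub>2_def mem_box_cart forall_2)
  ultimately show ?thesis by (simp add: has_integral_restrict_UNIV)
qed

text \<open>
  The cone with apex \<open>c\<close> over the boundary curve covers \<open>K\<close>. It is the image of a rectangle under
  \<open>(t, s) \<mapsto> c + t (X s - c)\<close>, whose Jacobian has absolute value \<open>t h(s)\<close>, and the measure of an
  image is at most the integral of the Jacobian.
\<close>
lemma area_le_half_support_integral:
  fixes K :: "(real^2) set" and X T :: "real \<Rightarrow> real^2"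
  assumes "bounded K" and frontier: "frontier K \<subseteq> X ` {p..q}" and "p \<le> q"
    and deriv: "\<And>s. (X has_vector_derivative T s) (at s)"
    and cont: "continuous_on {p..q} h" and nonneg: "\<And>s. s \<in> {p..q} \<Longrightarrow> 0 \<le> h s"
    and h: "\<And>s. s \<in> {p..q} \<Longrightarrow> \<bar>(X s - c)$1 * T s$2 - (X s - c)$2 * T s$1\<bar> = h s"
  shows "measure lebesgue K \<le> integral {p..q} h / 2"
proof -
  define S where "S = cbox (vector [0, p]) (vector [1, q] :: real^2)"
  define f where "f = (\<lambda>y::real^2. c + y$1 *\<^sub>R (X (y$2) - c))"
  define f' where "f' = (\<lambda>(y::real^2) (d::real^2). d$1 *\<^sub>R (X (y$2) - c) + (y$1 * d$2) *\<^sub>R T (y$2))"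
  have S: "y \<in> S \<longleftrightarrow> y$1 \<in> {0..1} \<and> y$2 \<in> {p..q}" for y
    by (auto simp: S_def mem_box_cart forall_2)
  have df: "(f has_derivative f' y) (at y within S)" for y
  proof -
    have coord: "((\<lambda>y::real^2. y$i) has_derivative (\<lambda>d. d$i)) (at y within S)" for i
      by (intro bounded_linear_imp_has_derivative bounded_linear_vec_nth)
    have "(X has_derivative (\<lambda>x. x *\<^sub>R T (y$2))) (at (y$2))"
      using deriv[of "y$2"] unfolding has_vector_derivative_def .
    from has_derivative_compose[OF coord this]
    have "((\<lambda>y. X (y$2) - c) has_derivative (\<lambda>d. d$2 *\<^sub>R T (y$2) - 0)) (at y within S)"
      by (rule has_derivative_diff[OF _ has_derivative_const])
    from has_derivative_add[OF has_derivative_const has_derivative_scaleR[OF coord[of 1] this]]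
    show ?thesis unfolding f_def
      by (rule has_derivative_eq_rhs) (simp add: f'_def fun_eq_iff)
  qed
  have det: "\<bar>det (matrix (f' y))\<bar> = y$1 * h (y$2)" if "y \<in> S" for y
  proof -
    have "det (matrix (f' y)) = y$1 * ((X (y$2) - c)$1 * T (y$2)$2 - (X (y$2) - c)$2 * T (y$2)$1)"
      by (simp add: det_2 matrix_def f'_def axis_def algebra_simps)
    moreover have "y$1 \<ge> 0" "y$2 \<in> {p..q}" using that S by auto
    ultimately show ?thesis using h by (simp add: abs_mult)
  qed
  have "((\<lambda>y. y$1 * h (y$2)) has_integral integral {p..q} h / 2) S"
    unfolding S_def using cont nonneg by (rule has_integral_product_rectangle)
  then have I: "((\<lambda>y. \<bar>det (matrix (f' y))\<bar>) has_integral integral {p..q} h / 2) S"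
    by (rule has_integral_eq[rotated]) (simp add: det)
  have "K \<subseteq> f ` S"
  proof
    fix x assume x: "x \<in> K"
    show "x \<in> f ` S"
    proof (cases "x = c")
      case True
      then show ?thesis using \<open>p \<le> q\<close>
        by (intro image_eqI[of _ _ "vector [0, p]"]) (auto simp: f_def S)
    next
      case False
      obtain y t where yt: "y \<in> frontier K" "0 \<le> t" "t \<le> 1" "x = c + t *\<^sub>R (y - c)"
        using bounded_subset_cone_of_frontier[OF \<open>bounded K\<close> x False] by blast
      then obtain s where "s \<in> {p..q}" "y = X s" using frontier by blast
      then show ?thesis using yt
        by (intro image_eqI[of _ _ "vector [t, s]"]) (auto simp: f_def S)
    qed
  qed
  have S_meas: "S \<in> sets lebesgue" by (simp add: S_def)
  have int: "(\<lambda>y. \<bar>det (matrix (f' y))\<bar>) integrable_on S" using I by (rule has_integral_integrable)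
  have fS: "f ` S \<in> lmeasurable"
    by (rule measurable_differentiable_image[OF S_meas df int])
  show ?thesis
  proof (cases "K \<in> sets lebesgue")
    case True
    then have "measure lebesgue K \<le> measure lebesgue (f ` S)"
      by (intro measure_mono_fmeasurable \<open>K \<subseteq> f ` S\<close> fS)
    also have "\<dots> \<le> integral S (\<lambda>y. \<bar>det (matrix (f' y))\<bar>)"
      by (rule measure_differentiable_image[OF S_meas df int])
    finally show ?thesis using integral_unique[OF I] by simp
  next
    case False
    then have "measure lebesgue K = 0" by (simp add: measure_notin_sets)
    moreover have "0 \<le> integral {p..q} h"
      using nonneg by (intro integral_nonneg integrable_continuous_real cont) auto
    ultimately show ?thesis by simp
  qed
qed

section \<open>Curvature and turning of a convex boundary curve\<close>

text \<open>
  The complement of \<open>K\<close> is the unbounded component of the complement of the curve; by the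
  Jordan-Brouwer theorem its frontier is the whole curve.
\<close>
lemma lamina_topology:
  fixes X :: "real \<Rightarrow> real^2"
  assumes curve: "arc_length_simple_closed X L" and lamina: "lamina_bounded_by K X"
  shows "compact K" "frontier K = range X"
proof -
  have L: "L > 0" and per: "\<And>s. X (s + L) = X s" and inj: "inj_on X {0..<L}"
    and smooth: "smooth_curve X"
    using curve by (auto simp: arc_length_simple_closed_def)
  have "X differentiable (at s)" for s
    using smooth[unfolded smooth_curve_def, rule_format, of 0 s] by simp
  then have cont: "continuous_on S X" for S
    by (intro continuous_at_imp_continuous_on ballI differentiable_imp_continuous_within)
  define \<gamma> where "\<gamma> = (\<lambda>t. X (L * t))"
  have range: "range X = \<gamma> ` {0..1}"
  proof
    show "range X \<subseteq> \<gamma> ` {0..1}"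
    proof (rule image_subsetI)
      fix s :: real
      obtain n :: int where n: "s + of_int n * L \<in> {0..<0 + L}"
        using periodic_representative[OF L] by blast
      have "X s = X (s + of_int n * L)" using periodic_int[of X L s n, OF per] by simp
      also have "\<dots> = \<gamma> ((s + of_int n * L) / L)" using L by (simp add: \<gamma>_def)
      finally show "X s \<in> \<gamma> ` {0..1}" using n L by (intro image_eqI[of _ _ "(s + of_int n * L) / L"]) auto
    qed
  qed (auto simp: \<gamma>_def)
  have \<gamma>: "simple_path \<gamma>" "pathfinish \<gamma> = pathstart \<gamma>"
  proof
    show "path \<gamma>" unfolding path_def \<gamma>_def
      by (intro continuous_on_compose2[OF cont[of UNIV]] continuous_intros) auto
    show end_start: "pathfinish \<gamma> = pathstart \<gamma>"
      using per[of 0] by (simp add: \<gamma>_def pathfinish_def pathstart_def)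
    fix x y :: real assume xy: "0 \<le> x" "x < y" "y \<le> 1" "\<gamma> x = \<gamma> y"
    show "x = 0 \<and> y = 1"
    proof (cases "y = 1")
      case True
      then have "X (L * x) = X 0" using xy per[of 0] by (simp add: \<gamma>_def)
      moreover have "L * x \<in> {0..<L}" using xy L by auto
      ultimately have "L * x = 0" using inj L by (auto dest!: inj_onD)
      then show ?thesis using L True by simp
    next
      case False
      then have "L * x \<in> {0..<L}" "L * y \<in> {0..<L}" using xy L by auto
      then have "L * x = L * y" using inj xy by (auto simp: \<gamma>_def dest: inj_onD)
      then show ?thesis using L xy by simp
    qed
  qed
  have cpt: "compact (range X)" unfolding range using \<gamma>
    by (metis compact_simple_path_image path_image_def)
  have "range X homeomorphic sphere (0::complex) 1"
    using homeomorphic_simple_path_image_circle[OF \<gamma>, of 1 0] by (simp add: range path_image_def)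
  then have sphere: "range X homeomorphic sphere (0::real^2) 1"
    by (rule homeomorphic_trans) (simp add: homeomorphic_spheres_gen)
  have "connected (outside (range X))"
    using compact_imp_bounded[OF cpt] by (intro connected_outside) simp_all
  moreover have "outside (range X) \<noteq> {}"
    using compact_imp_bounded[OF cpt] by (rule outside_bounded_nonempty)
  ultimately have "outside (range X) \<in> components (- range X)"
    by (simp add: outside_in_components)
  then have fr: "frontier (outside (range X)) = range X"
    by (intro Jordan_Brouwer_frontier[OF sphere]) simp_all
  have K: "K = - outside (range X)"
    using lamina by (simp add: lamina_bounded_by_def union_with_inside)
  have closed: "closed K" using open_outside[OF compact_imp_closed[OF cpt]] by (simp add: K closed_def)
  moreover have "bounded K"
    using lamina compact_imp_bounded[OF cpt] by (simp add: lamina_bounded_by_def bounded_inside)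
  ultimately show "compact K" by (simp add: compact_eq_bounded_closed)
  show "frontier K = range X" using fr by (simp add: K frontier_complement)
qed

lemma has_vector_derivative_translate:
  assumes "(f has_vector_derivative f') (at (s + a))"
  shows "((\<lambda>s. f (s + a)) has_vector_derivative f') (at s)"
proof -
  have "((\<lambda>s. s + a) has_vector_derivative 1) (at s)"
    by (auto intro!: derivative_eq_intros simp flip: has_real_derivative_iff_has_vector_derivative)
  from vector_diff_chain_at[OF this assms] show ?thesis by (simp add: o_def)
qed

locale convex_lamina =
  fixes K :: "(real^2) set" and X N :: "real \<Rightarrow> real^2" and L :: real
  assumes curve: "arc_length_simple_closed X L"
    and lamina: "lamina_bounded_by K X"
    and convex_K: "convex K"
    and normal: "inward_unit_normal K X N"
begin

lemmas compact_K = lamina_topology(1)[OF curve lamina]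
  and frontier_K = lamina_topology(2)[OF curve lamina]

lemma L_pos: "L > 0" and X_per: "X (s + L) = X s"
  using curve by (auto simp: arc_length_simple_closed_def)

definition T :: "real \<Rightarrow> real^2" where "T s = vector_derivative X (at s)"
definition D :: "real \<Rightarrow> real^2" where "D s = vector_derivative T (at s)"
definition \<kappa> :: "real \<Rightarrow> real" where "\<kappa> s = D s \<bullet> N s"

lemma T_norm: "norm (T s) = 1" and N_norm: "norm (N s) = 1" and N_T: "N s \<bullet> T s = 0"
  using curve normal by (auto simp: arc_length_simple_closed_def inward_unit_normal_def T_def)

lemma X_deriv: "(X has_vector_derivative T s) (at s)"
  and T_deriv: "(T has_vector_derivative D s) (at s)"
  and D_cont: "continuous_on UNIV D"
proof -
  have smooth: "((\<lambda>Y t. vector_derivative Y (at t)) ^^ n) X differentiable (at s)" for n s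
    using curve by (simp add: arc_length_simple_closed_def smooth_curve_def)
  have T: "T = (\<lambda>t. vector_derivative X (at t))" and D: "D = (\<lambda>t. vector_derivative T (at t))"
    by (simp_all add: T_def D_def fun_eq_iff)
  have diff: "X differentiable (at s)" "T differentiable (at s)" "D differentiable (at s)" for s
    using smooth[of 0 s] smooth[of 1 s] smooth[of 2 s] by (simp_all add: T D numeral_2_eq_2)
  show "(X has_vector_derivative T s) (at s)" "(T has_vector_derivative D s) (at s)"
    using diff by (simp_all only: T_def D_def flip: vector_derivative_works)
  show "continuous_on UNIV D"
    using diff(3) by (intro continuous_at_imp_continuous_on ballI differentiable_imp_continuous_within)
qed

lemma X_in_K: "X s \<in> K"
  using lamina by (simp add: lamina_bounded_by_def)

lemma X_inner_deriv: "((\<lambda>t. v \<bullet> X t) has_real_derivative v \<bullet> T s) (at s)"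
  using bounded_linear.has_vector_derivative[OF bounded_linear_inner_right X_deriv]
  by (simp add: has_real_derivative_iff_has_vector_derivative)

lemma T_inner_deriv: "((\<lambda>t. v \<bullet> T t) has_real_derivative v \<bullet> D s) (at s)"
  using bounded_linear.has_vector_derivative[OF bounded_linear_inner_right T_deriv]
  by (simp add: has_real_derivative_iff_has_vector_derivative)

lemma inner_point:
  obtains t where "t > 0" "X s + t *\<^sub>R N s \<in> interior K"
proof -
  have "\<forall>\<^sub>F t in at_right 0. X s + t *\<^sub>R N s \<in> interior K"
    using normal by (simp add: inward_unit_normal_def)
  moreover have "\<forall>\<^sub>F t in at_right (0::real). t > 0" by (simp add: eventually_at_right_less)
  ultimately have "\<forall>\<^sub>F t in at_right 0. X s + t *\<^sub>R N s \<in> interior K \<and> t > 0" by (rule eventually_conj)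
  then have "\<exists>t. X s + t *\<^sub>R N s \<in> interior K \<and> t > 0"
    by (rule eventually_happens'[rotated]) simp
  with that show ?thesis by blast
qed

text \<open>
  A linear functional that is minimal on \<open>K\<close> at \<open>X s\<close> is critical along the curve there, hence
  orthogonal to the tangent.
\<close>
lemma extremal_direction:
  assumes ge: "\<And>y. y \<in> K \<Longrightarrow> v \<bullet> X s \<le> v \<bullet> y"
  shows "v = (v \<bullet> N s) *\<^sub>R N s" "0 \<le> v \<bullet> N s"
proof -
  have "v \<bullet> T s = 0"
    by (rule DERIV_local_min[OF X_inner_deriv zero_less_one]) (use ge X_in_K in auto)
  then show "v = (v \<bullet> N s) *\<^sub>R N s"
    using orthonormal_expansion[OF N_norm T_norm N_T, of v s] by simp
  obtain t where t: "t > 0" "X s + t *\<^sub>R N s \<in> interior K" by (rule inner_point)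
  then have "v \<bullet> X s \<le> v \<bullet> (X s + t *\<^sub>R N s)" using interior_subset by (intro ge) blast
  then show "0 \<le> v \<bullet> N s" using t by (simp add: inner_add_right zero_le_mult_iff)
qed

lemma normal_supports:
  shows "y \<in> K \<Longrightarrow> 0 \<le> N s \<bullet> (y - X s)"
    and "y \<in> interior K \<Longrightarrow> 0 < N s \<bullet> (y - X s)"
proof -
  have "interior K \<noteq> {}" using inner_point by (metis empty_iff)
  then have ri: "rel_interior K = interior K" by (rule rel_interior_nonempty_interior)
  have "X s \<in> frontier K" by (simp add: frontier_K)
  then have ni: "X s \<notin> rel_interior K" by (simp add: ri frontier_def)
  obtain v where v: "v \<noteq> 0" "\<And>y. y \<in> K \<Longrightarrow> v \<bullet> X s \<le> v \<bullet> y"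
      "\<And>y. y \<in> rel_interior K \<Longrightarrow> v \<bullet> X s < v \<bullet> y"
  proof (rule supporting_hyperplane_rel_boundary[OF convex_K X_in_K ni])
    fix v
    assume "v \<noteq> 0" "\<And>y. y \<in> K \<Longrightarrow> v \<bullet> X s \<le> v \<bullet> y"
      "\<And>y. y \<in> rel_interior K \<Longrightarrow> v \<bullet> X s < v \<bullet> y"
    then show thesis by (rule that)
  qed
  have eq: "v = (v \<bullet> N s) *\<^sub>R N s" and "0 \<le> v \<bullet> N s" by (rule extremal_direction[OF v(2)], assumption)+
  moreover have "v \<bullet> N s \<noteq> 0" using eq v(1) by auto
  ultimately have pos: "0 < v \<bullet> N s" by simp
  have inner: "v \<bullet> (y - X s) = (v \<bullet> N s) * (N s \<bullet> (y - X s))" for y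
    by (metis eq inner_scaleR_left)
  show "0 \<le> N s \<bullet> (y - X s)" if "y \<in> K"
  proof -
    have "0 \<le> v \<bullet> (y - X s)" using v(2)[OF that] by (simp add: inner_diff_right)
    then show ?thesis unfolding inner using pos by (simp add: zero_le_mult_iff)
  qed
  show "0 < N s \<bullet> (y - X s)" if "y \<in> interior K"
  proof -
    have "0 < v \<bullet> (y - X s)" using v(3)[of y] that by (simp add: ri inner_diff_right)
    then show ?thesis unfolding inner using pos by (simp add: zero_less_mult_iff)
  qed
qed

text \<open>
  The sign cannot jump, because an interior point \<open>w\<close> never lies on a tangent line. This makes \<open>N\<close> as
  smooth as \<open>T\<close>.
\<close>
lemma normal_is_rotated_tangent:
  obtains \<sigma> :: real where "\<sigma> * \<sigma> = 1" "\<And>s. N s = \<sigma> *\<^sub>R rot (T s)"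
proof -
  obtain t where "X 0 + t *\<^sub>R N 0 \<in> interior K" by (rule inner_point)
  then obtain w where w: "w \<in> interior K" by blast
  define g where "g = (\<lambda>s. rot (T s) \<bullet> (w - X s))"
  have "continuous_on UNIV T" "continuous_on UNIV X"
    using T_deriv X_deriv by (auto intro!: has_vector_derivative_continuous continuous_at_imp_continuous_on)
  then have cont: "continuous_on UNIV g" unfolding g_def
    by (intro continuous_intros bounded_linear.continuous_on[OF bounded_linear_rot])
  have cases: "N s = rot (T s) \<and> 0 < g s \<or> N s = - rot (T s) \<and> g s < 0" for s
  proof -
    have "T s \<bullet> N s = 0" using N_T[of s] by (simp add: inner_commute)
    then have "N s = rot (T s) \<or> N s = - rot (T s)" by (intro orthonormal_rot T_norm N_norm)
    moreover have "0 < N s \<bullet> (w - X s)" by (rule normal_supports(2)[OF w])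
    ultimately show ?thesis by (auto simp: g_def)
  qed
  have "\<not> (g s < 0 \<and> 0 < g t)" for s t
  proof
    assume st: "g s < 0 \<and> 0 < g t"
    have "connected (g ` UNIV)" using cont by (rule connected_continuous_image) simp
    then have "0 \<in> g ` UNIV" using st
      by (intro connectedD_interval[of "g ` UNIV" "g s" "g t" 0]) auto
    then obtain u where "g u = 0" by auto
    with cases[of u] show False by simp
  qed
  then have "(\<forall>s. N s = rot (T s)) \<or> (\<forall>s. N s = - rot (T s))" using cases by metis
  then show ?thesis
  proof
    assume "\<forall>s. N s = rot (T s)"
    then show ?thesis by (intro that[of 1]) simp_all
  next
    assume "\<forall>s. N s = - rot (T s)"
    then show ?thesis by (intro that[of "- 1"]) simp_all
  qed
qed

lemma frenet_T: "(T has_vector_derivative \<kappa> s *\<^sub>R N s) (at s)"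
proof -
  have "((\<lambda>t. T t \<bullet> T t) has_vector_derivative T s \<bullet> D s + D s \<bullet> T s) (at s)"
    by (rule bounded_bilinear.has_vector_derivative[OF bounded_bilinear_inner T_deriv T_deriv])
  moreover have "(\<lambda>t. T t \<bullet> T t) = (\<lambda>t. 1)" using T_norm by (simp add: norm_eq_1)
  ultimately have "T s \<bullet> D s + D s \<bullet> T s = 0"
    using vector_derivative_unique_at[of "\<lambda>t. 1::real" _ s 0] by (simp add: has_vector_derivative_const)
  then have "D s \<bullet> T s = 0" by (simp add: inner_commute)
  then have "D s = \<kappa> s *\<^sub>R N s"
    using orthonormal_expansion[OF N_norm T_norm N_T, of "D s" s] by (simp add: \<kappa>_def)
  with T_deriv[of s] show ?thesis by simp
qed

lemma frenet_N: "(N has_vector_derivative - \<kappa> s *\<^sub>R T s) (at s)"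
proof -
  obtain \<sigma> :: real where \<sigma>: "\<sigma> * \<sigma> = 1" "\<And>s. N s = \<sigma> *\<^sub>R rot (T s)" by (rule normal_is_rotated_tangent) blast
  interpret rot: bounded_linear rot by (rule bounded_linear_rot)
  have "((\<lambda>s. \<sigma> *\<^sub>R rot (T s)) has_vector_derivative \<sigma> *\<^sub>R rot (\<kappa> s *\<^sub>R N s)) (at s)"
    by (intro bounded_linear.has_vector_derivative[OF bounded_linear_scaleR_right]
        bounded_linear.has_vector_derivative[OF bounded_linear_rot] frenet_T)
  moreover have "(\<lambda>s. \<sigma> *\<^sub>R rot (T s)) = N" using \<sigma> by auto
  moreover have "\<sigma> *\<^sub>R rot (\<kappa> s *\<^sub>R N s) = - \<kappa> s *\<^sub>R T s"
  proof -
    have "\<sigma> *\<^sub>R rot (\<kappa> s *\<^sub>R N s) = (\<kappa> s * (\<sigma> * \<sigma>)) *\<^sub>R rot (rot (T s))"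
      by (simp add: \<sigma>(2) rot.scaleR mult_ac)
    also have "\<dots> = - \<kappa> s *\<^sub>R T s" by (simp add: \<sigma>(1))
    finally show ?thesis .
  qed
  ultimately show ?thesis by simp
qed

lemma \<kappa>_cont: "continuous_on UNIV \<kappa>"
proof -
  have "continuous_on UNIV N"
    using frenet_N by (auto intro!: has_vector_derivative_continuous continuous_at_imp_continuous_on)
  then show ?thesis unfolding \<kappa>_def by (intro continuous_intros D_cont)
qed

text \<open>
  Negative curvature would bend the curve across its own supporting line.
\<close>
lemma \<kappa>_nonneg: "0 \<le> \<kappa> s"
proof (rule ccontr)
  assume "\<not> 0 \<le> \<kappa> s"
  then have "N s \<bullet> D s < 0" by (simp add: \<kappa>_def inner_commute)
  then obtain d where d: "d > 0" "\<And>h. 0 < h \<Longrightarrow> h < d \<Longrightarrow> N s \<bullet> T (s + h) < N s \<bullet> T s"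
    using DERIV_neg_dec_right[OF T_inner_deriv] by blast
  have "N s \<bullet> X (s + d) < N s \<bullet> X s"
  proof (rule DERIV_neg_imp_decreasing_open[where f = "\<lambda>t. N s \<bullet> X t"])
    show "s < s + d" using d by simp
    show "\<exists>y. ((\<lambda>t. N s \<bullet> X t) has_real_derivative y) (at x) \<and> y < 0" if "s < x" "x < s + d" for x
      using d(2)[of "x - s"] that N_T[of s]
      by (intro exI[of _ "N s \<bullet> T x"] conjI X_inner_deriv) simp
    show "continuous_on {s..s + d} (\<lambda>t. N s \<bullet> X t)"
      by (rule DERIV_continuous_on) (rule has_field_derivative_at_within[OF X_inner_deriv])
  qed
  then show False using normal_supports(1)[OF X_in_K, of s "s + d"] by (simp add: inner_diff_right)
qed

lemma T_per: "T (s + L) = T s"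
proof -
  have "((\<lambda>s. X (s + L)) has_vector_derivative T (s + L)) (at s)"
    by (intro has_vector_derivative_translate X_deriv)
  moreover have "(\<lambda>s. X (s + L)) = X" by (simp add: X_per fun_eq_iff)
  ultimately show ?thesis using X_deriv[of s] by (metis vector_derivative_unique_at)
qed

lemma N_per: "N (s + L) = N s"
proof -
  obtain \<sigma> :: real where "\<And>s. N s = \<sigma> *\<^sub>R rot (T s)" by (rule normal_is_rotated_tangent) blast
  then show ?thesis by (simp add: T_per)
qed

lemma \<kappa>_per: "\<kappa> (s + L) = \<kappa> s"
proof -
  have "((\<lambda>s. T (s + L)) has_vector_derivative D (s + L)) (at s)"
    by (intro has_vector_derivative_translate T_deriv)
  moreover have "(\<lambda>s. T (s + L)) = T" by (simp add: T_per fun_eq_iff)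
  ultimately have "D (s + L) = D s" using T_deriv[of s] by (metis vector_derivative_unique_at)
  then show ?thesis by (simp add: \<kappa>_def N_per)
qed

end

section \<open>The Bonnesen polynomial on the minimal annulus\<close>

context convex_lamina
begin

definition u\<^sub>0 :: "real^2" where "u\<^sub>0 = - N 0"
definition t\<^sub>0 :: "real^2" where "t\<^sub>0 = T 0"

lemma frame_at_0: "norm u\<^sub>0 = 1" "norm t\<^sub>0 = 1" "u\<^sub>0 \<bullet> t\<^sub>0 = 0"
  by (simp_all add: u\<^sub>0_def t\<^sub>0_def N_norm T_norm N_T)

text \<open>
  Rotating the moving frame back by the integral \<open>\<theta>\<close> of the curvature makes it constant.
\<close>
lemma tangent_angle:
  obtains \<theta> where "\<And>s. (\<theta> has_real_derivative \<kappa> s) (at s)" "\<theta> 0 = 0"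
    "\<And>s. - N s = cos (\<theta> s) *\<^sub>R u\<^sub>0 + sin (\<theta> s) *\<^sub>R t\<^sub>0"
    "\<And>s. T s = - sin (\<theta> s) *\<^sub>R u\<^sub>0 + cos (\<theta> s) *\<^sub>R t\<^sub>0"
proof -
  have "isCont \<kappa> s" for s using \<kappa>_cont by (simp add: continuous_on_eq_continuous_at)
  then obtain F where F: "\<And>s. (F has_vector_derivative \<kappa> s) (at s)"
    using einterval_antiderivative[of "-\<infinity>" "\<infinity>" \<kappa>] by auto
  define \<theta> where "\<theta> = (\<lambda>s. F s - F 0)"
  have \<theta>: "(\<theta> has_real_derivative \<kappa> s) (at s)" for s
    using F[of s] unfolding \<theta>_def has_real_derivative_iff_has_vector_derivative[symmetric]
    by (auto intro!: derivative_eq_intros)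
  have cos: "((\<lambda>s. cos (\<theta> s)) has_real_derivative - sin (\<theta> s) * \<kappa> s) (at s)"
   and sin: "((\<lambda>s. sin (\<theta> s)) has_real_derivative cos (\<theta> s) * \<kappa> s) (at s)" for s
    by (auto intro!: derivative_eq_intros \<theta>)
  define A where "A = (\<lambda>s. cos (\<theta> s) *\<^sub>R N s + sin (\<theta> s) *\<^sub>R T s)"
  define B where "B = (\<lambda>s. cos (\<theta> s) *\<^sub>R T s - sin (\<theta> s) *\<^sub>R N s)"
  have dA: "(A has_vector_derivative 0) (at s)" for s
  proof -
    have "(A has_vector_derivative
        (cos (\<theta> s) *\<^sub>R (- \<kappa> s *\<^sub>R T s) + (- sin (\<theta> s) * \<kappa> s) *\<^sub>R N s)
        + (sin (\<theta> s) *\<^sub>R (\<kappa> s *\<^sub>R N s) + (cos (\<theta> s) * \<kappa> s) *\<^sub>R T s)) (at s)"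
      unfolding A_def
      by (intro has_vector_derivative_add has_vector_derivative_scaleR cos sin frenet_N frenet_T)
    then show ?thesis by (simp add: mult.commute)
  qed
  have dB: "(B has_vector_derivative 0) (at s)" for s
  proof -
    have "(B has_vector_derivative
        (cos (\<theta> s) *\<^sub>R (\<kappa> s *\<^sub>R N s) + (- sin (\<theta> s) * \<kappa> s) *\<^sub>R T s)
        - (sin (\<theta> s) *\<^sub>R (- \<kappa> s *\<^sub>R T s) + (cos (\<theta> s) * \<kappa> s) *\<^sub>R N s)) (at s)"
      unfolding B_def
      by (intro has_vector_derivative_diff has_vector_derivative_scaleR cos sin frenet_N frenet_T)
    then show ?thesis by (simp add: mult.commute)
  qed
  have const: "f s = f 0" if "\<And>s. (f has_vector_derivative 0) (at s)" for f :: "real \<Rightarrow> real^2" and s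
    using has_vector_derivative_zero_constant[of UNIV f] that by (metis UNIV_I convex_UNIV)
  have A: "A s = - u\<^sub>0" and B: "B s = t\<^sub>0" for s
    using const[OF dA, of s] const[OF dB, of s] by (simp_all add: A_def B_def \<theta>_def u\<^sub>0_def t\<^sub>0_def)
  have one: "cos x * cos x + sin x * sin x = 1" for x :: real
    using sin_cos_squared_add3[of x] .
  have "- N s = cos (\<theta> s) *\<^sub>R u\<^sub>0 + sin (\<theta> s) *\<^sub>R t\<^sub>0" for s
  proof -
    have "cos (\<theta> s) *\<^sub>R u\<^sub>0 + sin (\<theta> s) *\<^sub>R t\<^sub>0 = sin (\<theta> s) *\<^sub>R B s - cos (\<theta> s) *\<^sub>R A s"
      by (simp add: A B)
    also have "\<dots> = - ((cos (\<theta> s) * cos (\<theta> s) + sin (\<theta> s) * sin (\<theta> s)) *\<^sub>R N s)"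
      by (simp add: A_def B_def algebra_simps
          del: sin_cos_squared_add sin_cos_squared_add2 sin_cos_squared_add3)
    finally show ?thesis by (simp only: one scaleR_one)
  qed
  moreover have "T s = - sin (\<theta> s) *\<^sub>R u\<^sub>0 + cos (\<theta> s) *\<^sub>R t\<^sub>0" for s
  proof -
    have "- sin (\<theta> s) *\<^sub>R u\<^sub>0 + cos (\<theta> s) *\<^sub>R t\<^sub>0 = cos (\<theta> s) *\<^sub>R B s + sin (\<theta> s) *\<^sub>R A s"
      by (simp add: A B)
    also have "\<dots> = (cos (\<theta> s) * cos (\<theta> s) + sin (\<theta> s) * sin (\<theta> s)) *\<^sub>R T s"
      by (simp add: A_def B_def algebra_simps
          del: sin_cos_squared_add sin_cos_squared_add2 sin_cos_squared_add3)
    finally show ?thesis by (simp only: one scaleR_one)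
  qed
  ultimately show ?thesis using \<theta> by (intro that[of \<theta>]) (simp_all add: \<theta>_def)
qed

text \<open>
  The frame closes up after one period, so the turning is a multiple of \<open>2 \<pi>\<close>, nonnegative by
  convexity. It is not zero, since otherwise the curve would be a straight line.
\<close>
lemma total_turning:
  assumes \<theta>: "\<And>s. (\<theta> has_real_derivative \<kappa> s) (at s)" "\<theta> 0 = 0"
    and N: "\<And>s. - N s = cos (\<theta> s) *\<^sub>R u\<^sub>0 + sin (\<theta> s) *\<^sub>R t\<^sub>0"
    and T: "\<And>s. T s = - sin (\<theta> s) *\<^sub>R u\<^sub>0 + cos (\<theta> s) *\<^sub>R t\<^sub>0"
  obtains k :: nat where "k \<ge> 1" "\<And>s. \<theta> (s + L) = \<theta> s + 2 * pi * k"
proof -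
  have mono: "\<theta> s \<le> \<theta> t" if "s \<le> t" for s t
    using DERIV_nonneg_imp_nondecreasing[OF that] \<theta>(1) \<kappa>_nonneg by blast
  define g where "g = (\<lambda>s. \<theta> (s + L) - \<theta> s)"
  have "(g has_real_derivative 0) (at s)" for s
  proof -
    have "((\<lambda>s. \<theta> (s + L)) has_real_derivative \<kappa> (s + L)) (at s)"
      using \<theta>(1)[of "s + L"] by (simp add: DERIV_shift)
    from DERIV_diff[OF this \<theta>(1)] show ?thesis by (simp add: g_def \<kappa>_per)
  qed
  then have const: "g s = g 0" for s using DERIV_isconst_all by blast
  have step: "\<theta> (s + L) = \<theta> s + \<theta> L" for s using const[of s] \<theta>(2) unfolding g_def by simp
  have "u\<^sub>0 = - N L" using N_per[of 0] by (simp add: u\<^sub>0_def)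
  also have "\<dots> = cos (\<theta> L) *\<^sub>R u\<^sub>0 + sin (\<theta> L) *\<^sub>R t\<^sub>0" by (rule N)
  finally have "u\<^sub>0 \<bullet> u\<^sub>0 = u\<^sub>0 \<bullet> (cos (\<theta> L) *\<^sub>R u\<^sub>0 + sin (\<theta> L) *\<^sub>R t\<^sub>0)" by (rule arg_cong)
  moreover have "u\<^sub>0 \<bullet> u\<^sub>0 = 1" using frame_at_0(1) by (simp add: norm_eq_1)
  ultimately have "cos (\<theta> L) = 1"
    unfolding inner_add_right inner_scaleR_right frame_at_0(3) by simp
  then obtain n :: int where n: "\<theta> L = of_int n * 2 * pi" by (auto simp: cos_one_2pi_int)
  have "0 \<le> \<theta> L" using mono[of 0 L] L_pos \<theta>(2) by simp
  then have "0 \<le> n" using n pi_gt_zero by (auto simp: zero_le_mult_iff)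
  have "n \<noteq> 0"
  proof
    assume "n = 0"
    have straight: "t\<^sub>0 \<bullet> T s = 1" if "0 < s" "s < L" for s
    proof -
      have "\<theta> s = 0" using mono[of 0 s] mono[of s L] that n \<open>n = 0\<close> \<theta>(2) by simp
      then show ?thesis using T[of s] frame_at_0 by (simp add: norm_eq_1)
    qed
    have "t\<^sub>0 \<bullet> X 0 < t\<^sub>0 \<bullet> X L"
    proof (rule DERIV_pos_imp_increasing_open[where f = "\<lambda>s. t\<^sub>0 \<bullet> X s"])
      show "\<exists>y. ((\<lambda>s. t\<^sub>0 \<bullet> X s) has_real_derivative y) (at s) \<and> 0 < y" if "0 < s" "s < L" for s
        using straight[OF that] by (intro exI[of _ "t\<^sub>0 \<bullet> T s"] conjI X_inner_deriv) simp
      show "continuous_on {0..L} (\<lambda>s. t\<^sub>0 \<bullet> X s)"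
        by (rule DERIV_continuous_on) (rule has_field_derivative_at_within[OF X_inner_deriv])
    qed (rule L_pos)
    then show False using X_per[of 0] by simp
  qed
  with \<open>0 \<le> n\<close> have "nat n \<ge> 1" "\<theta> L = 2 * pi * nat n" using n by simp_all
  with step show ?thesis by (intro that[of "nat n"]) simp_all
qed

lemma angle_surj:
  fixes \<theta> :: "real \<Rightarrow> real" and k :: nat
  assumes cont: "continuous_on UNIV \<theta>" and step: "\<And>s. \<theta> (s + L) = \<theta> s + 2 * pi * k" and "k \<ge> 1"
  shows "\<exists>s. \<theta> s = \<phi>"
proof -
  \<comment> \<open>Without its linear trend, \<open>\<theta>\<close> is periodic.\<close>
  define g where "g = (\<lambda>s. \<theta> s - 2 * pi * k / L * s)"
  have "g (s + L) = g s" for s using L_pos by (simp add: g_def step distrib_left add_divide_distrib)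
  then have "g (0 + of_int n * L) = g 0" for n by (rule periodic_int)
  then have "\<theta> (of_int n * L) - 2 * pi * k / L * (of_int n * L) = \<theta> 0" for n
    by (simp add: g_def)
  moreover have "2 * pi * k / L * (of_int n * L) = 2 * pi * k * of_int n" for n :: int
    using L_pos by simp
  ultimately have n: "\<theta> (of_int n * L) = \<theta> 0 + 2 * pi * k * of_int n" for n
    by (metis diff_add_cancel add.commute)
  define m where "m = \<lceil>\<bar>\<phi> - \<theta> 0\<bar> / (2 * pi * k)\<rceil>"
  have pos: "2 * pi * k > 0" using \<open>k \<ge> 1\<close> by simp
  have "\<bar>\<phi> - \<theta> 0\<bar> / (2 * pi * k) \<le> of_int m" unfolding m_def by linarith
  then have "\<bar>\<phi> - \<theta> 0\<bar> \<le> 2 * pi * k * of_int m" using pos by (simp add: pos_divide_le_eq mult.commute)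
  moreover have "0 \<le> m" using pos unfolding m_def by (simp add: order_less_le_trans[of "-1" 0])
  ultimately have "\<theta> (of_int (- m) * L) \<le> \<phi>" "\<phi> \<le> \<theta> (of_int m * L)" "of_int (- m) * L \<le> of_int m * L"
    using L_pos unfolding n by (auto intro!: mult_right_mono)
  then show ?thesis
    using IVT'[of \<theta> "of_int (- m) * L" \<phi> "of_int m * L"] continuous_on_subset[OF cont] by blast
qed

text \<open>
  All parts meet here: the balanced direction starts a period at a point \<open>a\<close> of the curve, and the
  period consists of \<open>2 k\<close> half turns to which Wirtinger's inequality applies.
\<close>
lemma bonnesen_annulus:
  assumes min: "minimal_annulus K c m M" and r: "r \<in> {m..M}"
  shows "bonnesen K L r \<ge> 0"
proof -
  have bound: "bounding_annulus K c m M" using min by (simp add: minimal_annulus_def)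
  then have cK: "c \<in> K" by (auto simp: bounding_annulus_def)
  interpret framed_body K c u\<^sub>0 t\<^sub>0
    using compact_K convex_K X_in_K frame_at_0 by unfold_locales auto
  obtain \<theta> where \<theta>: "\<And>s. (\<theta> has_real_derivative \<kappa> s) (at s)" "\<theta> 0 = 0"
    and N: "\<And>s. - N s = cos (\<theta> s) *\<^sub>R u\<^sub>0 + sin (\<theta> s) *\<^sub>R t\<^sub>0"
    and T: "\<And>s. T s = - sin (\<theta> s) *\<^sub>R u\<^sub>0 + cos (\<theta> s) *\<^sub>R t\<^sub>0"
    by (rule tangent_angle) blast
  obtain k :: nat where k: "k \<ge> 1" "\<And>s. \<theta> (s + L) = \<theta> s + 2 * pi * k"
    by (rule total_turning[OF \<theta> N T]) blast
  define h where "h = (\<lambda>s. (X s - c) \<bullet> - N s)"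
  define \<tau> where "\<tau> = (\<lambda>s. (X s - c) \<bullet> T s)"
  have Xc: "((\<lambda>s. X s - c) has_vector_derivative T s) (at s)" for s
    using has_vector_derivative_diff[OF X_deriv has_vector_derivative_const] by simp
  interpret support_profile h \<tau> \<kappa> \<theta>
  proof
    fix s
    have "((\<lambda>s. (X s - c) \<bullet> N s) has_vector_derivative
        (X s - c) \<bullet> (- \<kappa> s *\<^sub>R T s) + T s \<bullet> N s) (at s)"
      by (rule bounded_bilinear.has_vector_derivative[OF bounded_bilinear_inner Xc frenet_N])
    from has_vector_derivative_minus[OF this]
    show "(h has_real_derivative \<kappa> s * \<tau> s) (at s)"
      using N_T[of s] by (simp add: h_def \<tau>_def has_real_derivative_iff_has_vector_derivative inner_commute[of "T s" "N s"])
    have "((\<lambda>s. (X s - c) \<bullet> T s) has_vector_derivative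
        (X s - c) \<bullet> (\<kappa> s *\<^sub>R N s) + T s \<bullet> T s) (at s)"
      by (rule bounded_bilinear.has_vector_derivative[OF bounded_bilinear_inner Xc frenet_T])
    moreover have "T s \<bullet> T s = 1" using T_norm[of s] by (simp add: norm_eq_1)
    ultimately show "(\<tau> has_real_derivative 1 - \<kappa> s * h s) (at s)"
      by (simp add: h_def \<tau>_def has_real_derivative_iff_has_vector_derivative add.commute)
  qed (rule \<theta>(1) \<kappa>_nonneg \<kappa>_cont)+
  have EN: "E (\<theta> s) = - N s" for s using N[of s] by (simp add: E_def)
  have hH: "h s = H (\<theta> s)" for s
  proof -
    have "H (\<theta> s) = (X s - c) \<bullet> E (\<theta> s)"
      using normal_supports(1)[of _ s]
      by (intro H_eqI X_in_K) (simp add: EN inner_diff_right inner_commute[of _ "N s"])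
    then show ?thesis by (simp add: h_def EN)
  qed
  have h_nonneg: "0 \<le> h s" for s
    using normal_supports(1)[OF cK, of s] by (simp add: h_def inner_diff_left inner_diff_right inner_commute)
  have surj: "\<exists>s. \<theta> s = \<phi>" for \<phi>
    by (rule angle_surj[OF \<theta>_cont_on k(2,1)])
  \<comment> \<open>A zero of \<open>H\<close> means that \<open>c\<close> is a boundary point \<open>X p\<close>; then its direction is the normal at \<open>p\<close>.\<close>
  have smooth: "E s = E t" if st: "H s = 0" "H t = 0" for s t
  proof -
    have on_curve: "c \<in> range X"
    proof -
      obtain s' where "\<theta> s' = s" using surj by blast
      then have "N s' \<bullet> (c - X s') = 0" 
        using st(1) hH[of s'] by (simp add: h_def inner_diff_left inner_diff_right inner_commute)
      then have "c \<notin> interior K" using normal_supports(2)[of c s'] by auto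
      then show ?thesis using cK compact_imp_closed[OF compact_K] by (simp add: frontier_def flip: frontier_K)
    qed
    then obtain p where p: "c = X p" by blast
    have "E t = - N p" if "H t = 0" for t
    proof -
      have ge: "- E t \<bullet> X p \<le> - E t \<bullet> y" if "y \<in> K" for y
        using H_upper[OF that, of t] \<open>H t = 0\<close> by (simp add: p inner_diff_left inner_commute)
      have "- E t = (- E t \<bullet> N p) *\<^sub>R N p" "0 \<le> - E t \<bullet> N p"
        by (rule extremal_direction[OF ge], assumption)+
      moreover from this have "norm (- E t) = \<bar>- E t \<bullet> N p\<bar>"
        using N_norm[of p] by (metis mult.right_neutral norm_scaleR)
      ultimately have "- E t = N p" by simp
      then show ?thesis by (metis minus_minus)
    qed
    then show ?thesis using st by metis
  qed
  obtain \<phi> where \<phi>: "H \<phi> = H (\<phi> + pi)"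
    and half1: "\<forall>r\<in>{m..M}. \<exists>\<psi>\<in>{\<phi>..\<phi> + pi}. H \<psi> = r"
    and half2: "\<forall>r\<in>{m..M}. \<exists>\<psi>\<in>{\<phi> + pi..\<phi> + 2 * pi}. H \<psi> = r"
    by (rule balanced_direction[OF min smooth])
  obtain a where a: "\<theta> a = \<phi>" using surj by blast
  have H_per: "H (t + 2 * pi * j) = H t" for t and j :: nat
    using periodic_int[of H "2 * pi" t "int j", OF H_periodic] by (simp add: mult_ac)
  have ends: "H (\<theta> a + n * pi) = H (\<theta> a)" for n :: nat
  proof (cases "even n")
    case True
    then obtain j where "n = 2 * j" by blast
    then show ?thesis using H_per[of \<phi> j] by (simp add: a mult_ac)
  next
    case False
    then obtain j where "n = 2 * j + 1" by (rule oddE)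
    then show ?thesis using H_per[of "\<phi> + pi" j] \<phi> by (simp add: a algebra_simps)
  qed
  have zero: "\<exists>\<psi>\<in>{\<theta> a + n * pi..\<theta> a + (n + 1) * pi}. H \<psi> = r" for n :: nat
  proof (cases "even n")
    case True
    then obtain j where j: "n = 2 * j" by blast
    obtain \<psi> where "\<psi> \<in> {\<phi>..\<phi> + pi}" "H \<psi> = r" using half1 r by blast
    then show ?thesis using H_per[of \<psi> j]
      by (intro bexI[of _ "\<psi> + 2 * pi * j"]) (auto simp: a j algebra_simps)
  next
    case False
    then obtain j where j: "n = 2 * j + 1" by (rule oddE)
    obtain \<psi> where "\<psi> \<in> {\<phi> + pi..\<phi> + 2 * pi}" "H \<psi> = r" using half2 r by blast
    then show ?thesis using H_per[of \<psi> j]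
      by (intro bexI[of _ "\<psi> + 2 * pi * j"]) (auto simp: a j algebra_simps)
  qed
  \<comment> \<open>The number of half turns has the form \<open>Suc n\<close>, with \<open>n = 2 k - 1\<close> on the naturals as \<open>k \<ge> 1\<close>.\<close>
  have turn: "\<theta> (a + L) = \<theta> a + Suc (2 * k - 1) * pi"
    using k by (simp add: of_nat_diff)
  have "0 \<le> integral {a..a + L} (\<lambda>s. \<kappa> s * ((\<tau> s)\<^sup>2 - (h s - r)\<^sup>2))"
    by (rule wirtinger_turns[OF hH ends zero _ turn]) (use L_pos in simp)
  also have "\<dots> = 2 * r * L - integral {a..a + L} h - r\<^sup>2 * (2 * pi * k)"
    using energy_integral[of a "a + L" r] L_pos k(2)[of a]
    by (simp add: h_def \<tau>_def X_per N_per T_per)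
  finally have energy: "integral {a..a + L} h \<le> 2 * r * L - r\<^sup>2 * (2 * pi * k)" by simp
  have area: "measure lebesgue K \<le> integral {a..a + L} h / 2"
  proof (rule area_le_half_support_integral[where X = X and T = T and c = c])
    show "bounded K" using compact_K by (rule compact_imp_bounded)
    show "frontier K \<subseteq> X ` {a..a + L}"
    proof
      fix x assume "x \<in> frontier K"
      then obtain s where s: "x = X s" by (auto simp: frontier_K)
      obtain n :: int where "s + of_int n * L \<in> {a..<a + L}"
        using periodic_representative[OF L_pos] by blast
      moreover have "X s = X (s + of_int n * L)"
        using periodic_int[of X L s n, OF X_per] by simp
      ultimately show "x \<in> X ` {a..a + L}" unfolding s by (intro image_eqI) auto
    qed
    show "a \<le> a + L" using L_pos by simp
    show "\<bar>(X s - c) $ 1 * T s $ 2 - (X s - c) $ 2 * T s $ 1\<bar> = h s" for s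
    proof -
      have "T s \<bullet> N s = 0" using N_T[of s] by (simp add: inner_commute)
      then have "N s = rot (T s) \<or> N s = - rot (T s)" by (intro orthonormal_rot T_norm N_norm)
      then have "\<bar>(X s - c) $ 1 * T s $ 2 - (X s - c) $ 2 * T s $ 1\<bar> = \<bar>h s\<bar>"
        by (auto simp: h_def inner_vec_def sum_2)
      then show ?thesis using h_nonneg[of s] by simp
    qed
  qed (rule X_deriv h_cont_on h_nonneg)+
  have "r\<^sup>2 * (2 * pi) * 1 \<le> r\<^sup>2 * (2 * pi) * k" using k(1) by (intro mult_left_mono) simp_all
  then have "pi * r\<^sup>2 * 2 \<le> r\<^sup>2 * (2 * pi * k)" by (simp only: mult_ac mult_1_left mult_1_right)
  then have "measure lebesgue K \<le> L * r - pi * r\<^sup>2" using energy area mult.commute[of r L] by linarith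
  then show ?thesis by (simp add: bonnesen_def)
qed

lemma support_function_bounds:
  assumes "bounding_annulus K c m M"
  shows "m \<le> support_function X N c s" "support_function X N c s \<le> M"
proof -
  have "c - m *\<^sub>R N s \<in> K" using assms N_norm[of s] by (auto simp: bounding_annulus_def dist_norm)
  then have "0 \<le> N s \<bullet> (c - m *\<^sub>R N s - X s)" by (rule normal_supports)
  moreover have "N s \<bullet> N s = 1" using N_norm[of s] by (simp add: norm_eq_1)
  ultimately show "m \<le> support_function X N c s"
    by (simp add: support_function_def inner_diff_left inner_diff_right inner_commute)
  have "support_function X N c s \<le> norm (X s - c) * norm (- N s)"
    unfolding support_function_def by (rule norm_cauchy_schwarz)
  also have "\<dots> \<le> M" using assms X_in_K[of s] N_norm[of s]
    by (auto simp: bounding_annulus_def dist_norm norm_minus_commute)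
  finally show "support_function X N c s \<le> M" .
qed

end

theorem theorem3:
  fixes K :: "(real^2) set" and X N :: "real \<Rightarrow> real^2" and L :: real
    and c :: "real^2" and \<rho>\<^sub>i\<^sub>n \<rho>\<^sub>o\<^sub>u\<^sub>t :: real
  assumes "arc_length_simple_closed X L"
    and "lamina_bounded_by K X"
    and "convex K"
    and "inward_unit_normal K X N"
    and "minimal_annulus K c \<rho>\<^sub>i\<^sub>n \<rho>\<^sub>o\<^sub>u\<^sub>t"
  shows "(\<forall>r\<in>{\<rho>\<^sub>i\<^sub>n..\<rho>\<^sub>o\<^sub>u\<^sub>t}. bonnesen K L r \<ge> 0) \<and>
         (\<forall>s. \<rho>\<^sub>i\<^sub>n \<le> support_function X N c s \<and>
              support_function X N c s \<le> \<rho>\<^sub>o\<^sub>u\<^sub>t \<and>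
              bonnesen K L (support_function X N c s) \<ge> 0) \<and>
         positive_center K X L N c"
proof -
  interpret convex_lamina K X N L
    using assms(1-4) by unfold_locales
  have bound: "bounding_annulus K c \<rho>\<^sub>i\<^sub>n \<rho>\<^sub>o\<^sub>u\<^sub>t" using assms(5) by (simp add: minimal_annulus_def)
  show ?thesis
    using bonnesen_annulus[OF assms(5)] support_function_bounds[OF bound]
    by (simp add: positive_center_def)
qed

end
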